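(* Let $\Bbbk$ be a field and let $A=\Bbbk Q/I$ be a finite dimensional $\Bbbk$-algebra, where $Q$ is a finite connected quiver with $|Q_0|=k\geq 2$, $I$ is an admissible ideal of $\Bbbk Q$, and $\dim_{\Bbbk}(A)=n$. Then $$\operatorname{Frobdim}_{\Bbbk}(A)\leq \sum_{i\in Q_0} g\mathcal{P}^{+}(i)\cdot g\mathcal{P}^{-}(i)+2(n-k)-|Q_1|.$$
   Context: $Q_0$ and $Q_1$ are the sets of vertices and arrows of the quiver $Q$; $Q$ is connected if its underlying graph is connected. $\Bbbk Q$ is the path algebra (basis: all paths, including trivial ones; product: concatenation). With $R_Q$ the two-sided ideal generated by all arrows, an ideal $I$ of $\Bbbk Q$ ($Q$ finite) is admissible if $R_Q^m\subseteq I\subseteq R_Q^2$ for some $m\ge 2$. For a vertex $v$, $g\mathcal{P}^{+}(v)$ is the dimension of the subspace of $\Bbbk Q/I$ generated by the paths (of positive length) starting at $v$, and $g\mathcal{P}^{-}(v)$ is the dimension of the subspace of $\Bbbk Q/I$ generated by the paths (of positive length) ending at $v$. A nearly Frobenius coproduct on $A$ is a homomorphism of $A$-bimodules $\Delta:A\to A\otimes_{\Bbbk} A$, where $a\cdot(b\otimes c)\cdot d=ab\otimes cd$. $\operatorname{Frobdim}_{\Bbbk}(A)$ is the $\Bbbk$-dimension of the vector space of all nearly Frobenius coproducts on $A$. *)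

theory Defs
  imports
    "Graph_Theory.Digraph_Component"
    "HOL-Algebra.QuotRing"
    "HOL-Algebra.Ideal_Product"
    "Jordan_Normal_Form.Missing_VectorSpace"
begin

text \<open>
  Vector spaces are \<^locale>\<open>vectorspace\<close>s on records of type \<^type>\<open>module\<close>.  Such a record also
  has the fields \<^const>\<open>mult\<close> and \<^const>\<open>one\<close>; a \<open>\<bbbk>\<close>-algebra is a record in which these carry the
  product, and in a plain vector space they are irrelevant.
\<close>

section \<open>Free modules and quotients\<close>

definition free_module :: "('k, 'r) ring_scheme \<Rightarrow> 'b set \<Rightarrow> ('k, 'b \<Rightarrow> 'k) module" where
  "free_module K B =
    \<lparr> carrier = {f. (\<forall>b\<in>B. f b \<in> carrier K) \<and> (\<forall>b. b \<notin> B \<longrightarrow> f b = \<zero>\<^bsub>K\<^esub>)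
                    \<and> finite {b. f b \<noteq> \<zero>\<^bsub>K\<^esub>}},
      mult = undefined,
      one = undefined,
      zero = (\<lambda>b. \<zero>\<^bsub>K\<^esub>),
      add = (\<lambda>f g b. f b \<oplus>\<^bsub>K\<^esub> g b),
      smult = (\<lambda>c f b. c \<otimes>\<^bsub>K\<^esub> f b) \<rparr>"

definition basis_elem :: "('k, 'r) ring_scheme \<Rightarrow> 'b \<Rightarrow> 'b \<Rightarrow> 'k" where
  "basis_elem K b = (\<lambda>x. if x = b then \<one>\<^bsub>K\<^esub> else \<zero>\<^bsub>K\<^esub>)"

text \<open>
  \<^const>\<open>FactRing\<close> with the induced scalar multiplication, so that it serves both for the quotient of
  an algebra by an ideal and for the quotient of a vector space by a subspace.
\<close>

definition quot_module :: "('k, 'a, 's) module_scheme \<Rightarrow> 'a set \<Rightarrow> ('k, 'a set) module" where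
  "quot_module M N =
    \<lparr> carrier = carrier (M Quot N),
      mult = mult (M Quot N),
      one = one (M Quot N),
      zero = zero (M Quot N),
      add = add (M Quot N),
      smult = (\<lambda>c X. \<Union>x\<in>X. N +>\<^bsub>M\<^esub> (c \<odot>\<^bsub>M\<^esub> x)) \<rparr>"


section \<open>Tensor products\<close>

definition tensor_relations ::
  "('k, 'r) ring_scheme \<Rightarrow> ('k, 'a, 's) module_scheme \<Rightarrow> ('k, 'b, 't) module_scheme
    \<Rightarrow> ('a \<times> 'b \<Rightarrow> 'k) set" where
  "tensor_relations K M N =
    (let F = free_module K (carrier M \<times> carrier N); d = basis_elem K in
      {d (x \<oplus>\<^bsub>M\<^esub> x', y) \<ominus>\<^bsub>F\<^esub> (d (x, y) \<oplus>\<^bsub>F\<^esub> d (x', y)) | x x' y.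
         x \<in> carrier M \<and> x' \<in> carrier M \<and> y \<in> carrier N}
    \<union> {d (x, y \<oplus>\<^bsub>N\<^esub> y') \<ominus>\<^bsub>F\<^esub> (d (x, y) \<oplus>\<^bsub>F\<^esub> d (x, y')) | x y y'.
         x \<in> carrier M \<and> y \<in> carrier N \<and> y' \<in> carrier N}
    \<union> {d (c \<odot>\<^bsub>M\<^esub> x, y) \<ominus>\<^bsub>F\<^esub> (c \<odot>\<^bsub>F\<^esub> d (x, y)) | c x y.
         c \<in> carrier K \<and> x \<in> carrier M \<and> y \<in> carrier N}
    \<union> {d (x, c \<odot>\<^bsub>N\<^esub> y) \<ominus>\<^bsub>F\<^esub> (c \<odot>\<^bsub>F\<^esub> d (x, y)) | c x y.
         c \<in> carrier K \<and> x \<in> carrier M \<and> y \<in> carrier N})"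

definition tensor_null ::
  "('k, 'r) ring_scheme \<Rightarrow> ('k, 'a, 's) module_scheme \<Rightarrow> ('k, 'b, 't) module_scheme
    \<Rightarrow> ('a \<times> 'b \<Rightarrow> 'k) set" where
  "tensor_null K M N =
    module.span K (free_module K (carrier M \<times> carrier N)) (tensor_relations K M N)"

definition tensor_module ::
  "('k, 'r) ring_scheme \<Rightarrow> ('k, 'a, 's) module_scheme \<Rightarrow> ('k, 'b, 't) module_scheme
    \<Rightarrow> ('k, ('a \<times> 'b \<Rightarrow> 'k) set) module" where
  "tensor_module K M N =
    quot_module (free_module K (carrier M \<times> carrier N)) (tensor_null K M N)"

definition pure_tensor ::
  "('k, 'r) ring_scheme \<Rightarrow> ('k, 'a, 's) module_scheme \<Rightarrow> ('k, 'b, 't) module_scheme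
    \<Rightarrow> 'a \<Rightarrow> 'b \<Rightarrow> ('a \<times> 'b \<Rightarrow> 'k) set" where
  "pure_tensor K M N x y =
    tensor_null K M N +>\<^bsub>free_module K (carrier M \<times> carrier N)\<^esub> basis_elem K (x, y)"


section \<open>Nearly Frobenius coproducts\<close>

text \<open>
  The \<open>A\<close>-bimodule structure of \<open>A \<otimes> A\<close>, i.e. the linear extension of
  \<open>a \<cdot> (b \<otimes> c) \<cdot> d = ab \<otimes> cd\<close>.  A tensor \<open>t\<close> is a coset of formal combinations \<open>f\<close> of pairs, and the
  sum below does not depend on the choice of \<open>f \<in> t\<close>, whence \<^const>\<open>the_elem\<close>.
\<close>

definition bimodule_action ::
  "('k, 'r) ring_scheme \<Rightarrow> ('k, 'a, 's) module_scheme
    \<Rightarrow> 'a \<Rightarrow> ('a \<times> 'a \<Rightarrow> 'k) set \<Rightarrow> 'a \<Rightarrow> ('a \<times> 'a \<Rightarrow> 'k) set" where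
  "bimodule_action K A a t d =
    the_elem ((\<lambda>f. \<Oplus>\<^bsub>tensor_module K A A\<^esub> p \<in> {p. f p \<noteq> \<zero>\<^bsub>K\<^esub>}.
        f p \<odot>\<^bsub>tensor_module K A A\<^esub> pure_tensor K A A (a \<otimes>\<^bsub>A\<^esub> fst p) (snd p \<otimes>\<^bsub>A\<^esub> d)) ` t)"

text \<open>
  The coproducts are required to be \<^const>\<open>extensional\<close>, so that maps agreeing on the carrier of \<open>A\<close>
  are identified.
\<close>

definition nearly_frobenius_coproducts ::
  "('k, 'r) ring_scheme \<Rightarrow> ('k, 'a, 's) module_scheme \<Rightarrow> ('a \<Rightarrow> ('a \<times> 'a \<Rightarrow> 'k) set) set" where
  "nearly_frobenius_coproducts K A =
    {\<Delta>. \<Delta> \<in> module_hom K A (tensor_module K A A) \<and> \<Delta> \<in> extensional (carrier A)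
       \<and> (\<forall>a\<in>carrier A. \<forall>x\<in>carrier A. \<forall>d\<in>carrier A.
            \<Delta> (a \<otimes>\<^bsub>A\<^esub> x \<otimes>\<^bsub>A\<^esub> d) = bimodule_action K A a (\<Delta> x) d)}"

definition coproduct_space ::
  "('k, 'r) ring_scheme \<Rightarrow> ('k, 'a, 's) module_scheme
    \<Rightarrow> ('k, 'a \<Rightarrow> ('a \<times> 'a \<Rightarrow> 'k) set) module" where
  "coproduct_space K A =
    \<lparr> carrier = nearly_frobenius_coproducts K A,
      mult = undefined,
      one = undefined,
      zero = (\<lambda>x\<in>carrier A. \<zero>\<^bsub>tensor_module K A A\<^esub>),
      add = (\<lambda>f g. \<lambda>x\<in>carrier A. f x \<oplus>\<^bsub>tensor_module K A A\<^esub> g x),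
      smult = (\<lambda>c f. \<lambda>x\<in>carrier A. c \<odot>\<^bsub>tensor_module K A A\<^esub> f x) \<rparr>"

definition Frobdim :: "('k, 'r) ring_scheme \<Rightarrow> ('k, 'a, 's) module_scheme \<Rightarrow> nat" where
  "Frobdim K A = vectorspace.dim K (coproduct_space K A)"


section \<open>Bound quiver algebras\<close>

text \<open>
  A quiver is a \<^type>\<open>pre_digraph\<close>, loops and parallel arrows being allowed.  A path is its starting
  vertex together with the list of its arrows in order of traversal, so that \<open>(v, [])\<close> is the trivial
  path at \<open>v\<close>.
\<close>

definition quiver_paths :: "('v, 'e) pre_digraph \<Rightarrow> ('v \<times> 'e awalk) set" where
  "quiver_paths Q = {(u, es). \<exists>v. pre_digraph.awalk Q u es v}"

text \<open>
  The product is the bilinear extension of concatenation: the coefficient of \<open>f g\<close> at a path is the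
  sum over all ways to cut this path into an initial and a final segment.
\<close>

definition path_algebra ::
  "('k, 'r) ring_scheme \<Rightarrow> ('v, 'e) pre_digraph \<Rightarrow> ('k, 'v \<times> 'e awalk \<Rightarrow> 'k) module" where
  "path_algebra K Q = (free_module K (quiver_paths Q))
    \<lparr> mult := (\<lambda>f g (u, es). \<Oplus>\<^bsub>K\<^esub> i \<in> {..length es}.
          f (u, take i es) \<otimes>\<^bsub>K\<^esub> g (pre_digraph.awlast Q u (take i es), drop i es)),
      one := (\<lambda>(u, es). if u \<in> verts Q \<and> es = [] then \<one>\<^bsub>K\<^esub> else \<zero>\<^bsub>K\<^esub>) \<rparr>"

definition arrow_ideal ::
  "('k, 'r) ring_scheme \<Rightarrow> ('v, 'e) pre_digraph \<Rightarrow> ('v \<times> 'e awalk \<Rightarrow> 'k) set" where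
  "arrow_ideal K Q =
    genideal (path_algebra K Q) ((\<lambda>e. basis_elem K (tail Q e, [e])) ` arcs Q)"

definition admissible_ideal ::
  "('k, 'r) ring_scheme \<Rightarrow> ('v, 'e) pre_digraph \<Rightarrow> ('v \<times> 'e awalk \<Rightarrow> 'k) set \<Rightarrow> bool" where
  "admissible_ideal K Q I \<longleftrightarrow>
    ideal I (path_algebra K Q) \<and>
    (\<exists>m::nat. m \<ge> 2 \<and> arrow_ideal K Q [^]\<^bsub>ideals_set (path_algebra K Q)\<^esub> m \<subseteq> I) \<and>
    I \<subseteq> arrow_ideal K Q [^]\<^bsub>ideals_set (path_algebra K Q)\<^esub> (2::nat)"

definition bound_quiver_algebra ::
  "('k, 'r) ring_scheme \<Rightarrow> ('v, 'e) pre_digraph \<Rightarrow> ('v \<times> 'e awalk \<Rightarrow> 'k) set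
    \<Rightarrow> ('k, ('v \<times> 'e awalk \<Rightarrow> 'k) set) module" where
  "bound_quiver_algebra K Q I = quot_module (path_algebra K Q) I"

definition path_class ::
  "('k, 'r) ring_scheme \<Rightarrow> ('v, 'e) pre_digraph \<Rightarrow> ('v \<times> 'e awalk \<Rightarrow> 'k) set
    \<Rightarrow> 'v \<times> 'e awalk \<Rightarrow> ('v \<times> 'e awalk \<Rightarrow> 'k) set" where
  "path_class K Q I p = I +>\<^bsub>path_algebra K Q\<^esub> basis_elem K p"

definition paths_from :: "('v, 'e) pre_digraph \<Rightarrow> 'v \<Rightarrow> ('v \<times> 'e awalk) set" where
  "paths_from Q v = {(v, es) | es w. es \<noteq> [] \<and> pre_digraph.awalk Q v es w}"

definition paths_to :: "('v, 'e) pre_digraph \<Rightarrow> 'v \<Rightarrow> ('v \<times> 'e awalk) set" where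
  "paths_to Q v = {(u, es) | u es. es \<noteq> [] \<and> pre_digraph.awalk Q u es v}"

definition span_dim ::
  "('k, 'r) ring_scheme \<Rightarrow> ('k, 'a, 's) module_scheme \<Rightarrow> 'a set \<Rightarrow> nat" where
  "span_dim K V S = vectorspace.dim K (V\<lparr>carrier := module.span K V S\<rparr>)"

definition gP_plus ::
  "('k, 'r) ring_scheme \<Rightarrow> ('v, 'e) pre_digraph \<Rightarrow> ('v \<times> 'e awalk \<Rightarrow> 'k) set \<Rightarrow> 'v \<Rightarrow> nat" where
  "gP_plus K Q I v =
    span_dim K (bound_quiver_algebra K Q I) (path_class K Q I ` paths_from Q v)"

definition gP_minus ::
  "('k, 'r) ring_scheme \<Rightarrow> ('v, 'e) pre_digraph \<Rightarrow> ('v \<times> 'e awalk \<Rightarrow> 'k) set \<Rightarrow> 'v \<Rightarrow> nat" where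
  "gP_minus K Q I v =
    span_dim K (bound_quiver_algebra K Q I) (path_class K Q I ` paths_to Q v)"

end

theory Submission
  imports Defs
begin

text \<open>
  A bimodule map \<open>\<Delta>\<close> is determined by the tensor \<open>t = \<Delta> 1\<close>, and \<open>t\<close> is central: \<open>a t = t a\<close> for all \<open>a\<close>,
  since both sides are \<open>\<Delta> a\<close>.  So \<open>Frobdim\<close> is at most the dimension of the space of central tensors in
  \<open>A \<otimes> A\<close> (lemma \<open>Frobdim_le\<close>), and it suffices to exhibit enough linear conditions that centrality
  imposes.

  Let \<open>B\<close> be a finite set of paths that contains the trivial paths \<open>e\<^sub>v\<close> and the arrows and whose classes
  form a basis of \<open>A\<close> (\<open>path_basis_exists\<close>).  It exists because \<open>I\<close> lies in the square of the arrow
  ideal, so that the classes of the paths of length at most one are independent.  Write \<open>g (b, c)\<close> for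
  the coefficient of \<open>t\<close> at \<open>b \<otimes> c\<close>.  Comparing coefficients gives the following.

    \<^item> From \<open>e\<^sub>v t = t e\<^sub>v\<close>: \<open>g (b, c) = 0\<close> unless \<open>b\<close> starts where \<open>c\<close> ends.
    \<^item> From \<open>\<alpha> t = t \<alpha>\<close> for an arrow \<open>\<alpha>\<close> from \<open>i\<close> to \<open>j\<close>, at \<open>e\<^sub>i \<otimes> \<alpha>\<close>, \<open>\<alpha> \<otimes> e\<^sub>j\<close> and \<open>\<alpha> \<otimes> \<alpha>\<close>:
      \<open>g (e\<^sub>i, e\<^sub>i) = 0\<close>, \<open>g (e\<^sub>j, e\<^sub>j) = 0\<close> and \<open>g (e\<^sub>j, \<alpha>) = g (\<alpha>, e\<^sub>i)\<close>.

  In the second item only trivial paths and arrows are involved, and there the coefficients of an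
  element of \<open>A\<close> can be read off from any representative in the path algebra, again because \<open>I\<close> vanishes
  on short paths (\<open>coord_short\<close>).  As \<open>Q\<close> is connected with at least two vertices, every vertex is an end
  of an arrow, so all \<open>g (e\<^sub>v, e\<^sub>v)\<close> vanish.

  Hence \<open>t\<close> is determined by the values of \<open>g\<close> on the pairs \<open>(b, c)\<close> in which \<open>b\<close> starts where \<open>c\<close> ends,
  other than the \<open>k\<close> pairs \<open>(e\<^sub>v, e\<^sub>v)\<close> and the \<open>|Q\<^sub>1|\<close> pairs \<open>(e\<^sub>j, \<alpha>)\<close>.  If \<open>p\<^sub>v\<close> and \<open>m\<^sub>v\<close> count the elements of \<open>B\<close> of
  positive length that start and end at \<open>v\<close>, then the number of these pairs is
  \<open>\<Sum>\<^sub>v (1 + p\<^sub>v) (1 + m\<^sub>v) - k - |Q\<^sub>1| = \<Sum>\<^sub>v p\<^sub>v m\<^sub>v + 2 (|B| - k) - |Q\<^sub>1|\<close>,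
  and independence of \<open>B\<close> bounds \<open>p\<^sub>v\<close>, \<open>m\<^sub>v\<close> and \<open>|B|\<close> by the dimensions in the claim.
\<close>

section \<open>Linear maps and dimension\<close>

lemma vectorspace_cong:
  assumes V: "vectorspace K V"
    and "carrier W = carrier V" "\<zero>\<^bsub>W\<^esub> = \<zero>\<^bsub>V\<^esub>"
    and "\<And>x y. x \<in> carrier V \<Longrightarrow> y \<in> carrier V \<Longrightarrow> x \<oplus>\<^bsub>W\<^esub> y = x \<oplus>\<^bsub>V\<^esub> y"
    and "\<And>c x. c \<in> carrier K \<Longrightarrow> x \<in> carrier V \<Longrightarrow> c \<odot>\<^bsub>W\<^esub> x = c \<odot>\<^bsub>V\<^esub> x"
  shows "vectorspace K W"
proof -
  interpret V: vectorspace K V by fact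
  show ?thesis
    by (rule vs_criteria)
      (use assms V.field_axioms V.M.add.inv_closed V.M.r_neg in
        \<open>auto simp: V.M.a_assoc V.smult_assoc1 V.smult_l_distr V.smult_r_distr intro: V.M.a_comm\<close>)
qed

lemma module_homI:
  assumes "\<And>x. x \<in> carrier V \<Longrightarrow> f x \<in> carrier W"
    and "\<And>x y. x \<in> carrier V \<Longrightarrow> y \<in> carrier V \<Longrightarrow> f (x \<oplus>\<^bsub>V\<^esub> y) = f x \<oplus>\<^bsub>W\<^esub> f y"
    and "\<And>c x. c \<in> carrier K \<Longrightarrow> x \<in> carrier V \<Longrightarrow> f (c \<odot>\<^bsub>V\<^esub> x) = c \<odot>\<^bsub>W\<^esub> f x"
  shows "f \<in> module_hom K V W"
  using assms by (auto simp: module_hom_def)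

lemma module_hom_mem: "f \<in> module_hom K V W \<Longrightarrow> x \<in> carrier V \<Longrightarrow> f x \<in> carrier W"
  by (auto simp: module_hom_def)

lemma module_hom_comp:
  assumes "f \<in> module_hom K U V" "g \<in> module_hom K V W"
  shows "(\<lambda>x. g (f x)) \<in> module_hom K U W"
  using assms by (auto simp: module_hom_def Pi_iff)

lemma linear_mapI:
  assumes "vectorspace K V" "vectorspace K W" "f \<in> module_hom K V W"
  shows "linear_map K V W f"
  using assms by (auto simp: linear_map_def mod_hom_def mod_hom_axioms_def vectorspace_def)

text \<open>
  Two linear maps that agree on generators agree everywhere: their equalizer is a submodule that contains
  the generators.  This is how equalities of linear maps are proved below.
\<close>

lemma equalizer_submodule:
  assumes "vectorspace K V" "vectorspace K W" "f \<in> module_hom K V W" "g \<in> module_hom K V W"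
  shows "submodule K {x \<in> carrier V. f x = g x} V"
proof -
  interpret f: linear_map K V W f by (rule linear_mapI) fact+
  interpret g: linear_map K V W g by (rule linear_mapI) fact+
  show ?thesis
    by (rule submodule.intro) (use assms(1) in \<open>auto simp: vectorspace_def\<close>)
qed

lemma linear_inj_li:
  assumes lin: "linear_map K V W T" and inj: "inj_on T (carrier V)"
    and S: "S \<subseteq> carrier V" "finite S" and li: "\<not> module.lin_dep K V S"
  shows "\<not> module.lin_dep K W (T ` S)"
proof -
  interpret linear_map K V W T by fact
  have injS: "inj_on T S" using inj S inj_on_subset by blast
  show ?thesis
  proof (rule W.module.finite_lin_indpt2)
    fix a assume a: "a \<in> T ` S \<rightarrow> carrier K" and z: "W.module.lincomb a (T ` S) = \<zero>\<^bsub>W\<^esub>"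
    have c: "a \<circ> T \<in> S \<rightarrow> carrier K" using a by auto
    have "T (V.module.lincomb (a \<circ> T) S) = \<zero>\<^bsub>W\<^esub>"
      using lincomb_linear_image[OF inj S(1) a S(2)] z by simp
    then have 0: "V.module.lincomb (a \<circ> T) S = \<zero>\<^bsub>V\<^esub>"
      using inj_onD[OF inj, of "V.module.lincomb (a \<circ> T) S" "\<zero>\<^bsub>V\<^esub>"] S c by simp
    have "a \<circ> T \<in> S \<rightarrow> {\<zero>\<^bsub>K\<^esub>}"
      by (rule V.not_lindepD[OF li S(2) subset_refl c 0])
    then show "\<forall>v\<in>T ` S. a v = \<zero>\<^bsub>K\<^esub>" by auto
  qed (use S in auto)
qed

text \<open>
  The main tool for dimension estimates.  Finite dimensionality of the source has to be part of the
  conclusion, since the dimension is the least size of a finite generating set and means nothing without one.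
  The cardinality of an independent set of \<open>V\<close> is bounded through its image in \<open>W\<close>, so there is a maximal
  one, which is a basis.
\<close>

lemma linear_inj_dim_le:
  assumes V: "vectorspace K V" and W: "vectorspace K W" and T: "T \<in> module_hom K V W"
    and inj: "inj_on T (carrier V)" and fd: "vectorspace.fin_dim K W"
  shows "vectorspace.fin_dim K V" "vectorspace.dim K V \<le> vectorspace.dim K W"
proof -
  have lin: "linear_map K V W T" by (rule linear_mapI) fact+
  interpret linear_map K V W T by fact
  let ?P = "\<lambda>S. S \<subseteq> carrier V \<and> V.module.lin_indpt S"
  have fin: "finite S \<and> card S \<le> W.dim" if "?P S" "finite S" for S
  proof -
    have "W.module.lin_indpt (T ` S)" using linear_inj_li[OF lin inj] that by blast
    moreover have "T ` S \<subseteq> carrier W" using that by auto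
    ultimately have "card (T ` S) \<le> W.dim" using W.li_le_dim(2)[OF fd] by blast
    moreover have "inj_on T S" using inj that inj_on_subset by blast
    ultimately show ?thesis using that by (simp add: card_image)
  qed
  have bound: "finite S \<and> card S \<le> W.dim" if P: "?P S" for S
  proof (rule ccontr)
    assume "\<not> ?thesis"
    then have "infinite S" using fin P by blast
    then obtain S' where S': "S' \<subseteq> S" "finite S'" "card S' = Suc W.dim"
      using infinite_arbitrarily_large by metis
    then have "?P S'" using P V.module.subset_li_is_li by blast
    then show False using fin[of S'] S' by simp
  qed
  have "?P {}" by (auto simp: V.module.lin_dep_def)
  then obtain S where S: "finite S" "maximal S ?P"
    using maximal_exists[of ?P W.dim "{}"] bound by blast
  have basis: "V.basis S" by (rule V.max_li_is_basis) fact
  then show "V.fin_dim" using S unfolding V.fin_dim_def V.basis_def by blast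
  have "V.dim = card S" by (rule V.dim_basis) fact+
  then show "V.dim \<le> W.dim" using bound basis unfolding V.basis_def by auto
qed

section \<open>Free modules\<close>

lemma free_module_simps [simp]:
  "\<zero>\<^bsub>free_module K B\<^esub> = (\<lambda>b. \<zero>\<^bsub>K\<^esub>)"
  "f \<oplus>\<^bsub>free_module K B\<^esub> g = (\<lambda>b. f b \<oplus>\<^bsub>K\<^esub> g b)"
  "c \<odot>\<^bsub>free_module K B\<^esub> f = (\<lambda>b. c \<otimes>\<^bsub>K\<^esub> f b)"
  by (auto simp: free_module_def)

lemma free_module_carrier:
  "f \<in> carrier (free_module K B) \<longleftrightarrow>
    (\<forall>b\<in>B. f b \<in> carrier K) \<and> (\<forall>b. b \<notin> B \<longrightarrow> f b = \<zero>\<^bsub>K\<^esub>) \<and> finite {b. f b \<noteq> \<zero>\<^bsub>K\<^esub>}"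
  by (simp add: free_module_def)

text \<open>
  The linear extension of a map \<open>h\<close> that is given on the basis.
\<close>

definition free_ext ::
  "('k, 'r) ring_scheme \<Rightarrow> ('k, 'c, 'd) module_scheme \<Rightarrow> ('b \<Rightarrow> 'c) \<Rightarrow> ('b \<Rightarrow> 'k) \<Rightarrow> 'c" where
  "free_ext K W h f = (\<Oplus>\<^bsub>W\<^esub> b \<in> {b. f b \<noteq> \<zero>\<^bsub>K\<^esub>}. f b \<odot>\<^bsub>W\<^esub> h b)"

context field
begin

abbreviation "free B \<equiv> free_module R B"

lemma free_carrier_app [simp]:
  assumes "f \<in> carrier (free B)" shows "f b \<in> carrier R"
  using assms by (cases "b \<in> B") (auto simp: free_module_carrier)

lemma free_carrierI:
  assumes "\<And>b. b \<in> B \<Longrightarrow> f b \<in> carrier R" "\<And>b. f b \<noteq> \<zero> \<Longrightarrow> b \<in> F" "F \<subseteq> B" "finite F"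
  shows "f \<in> carrier (free B)"
  using assms by (auto simp: free_module_carrier intro: finite_subset[of _ F])

lemma free_support: "f \<in> carrier (free B) \<Longrightarrow> finite {b. f b \<noteq> \<zero>}" "f \<in> carrier (free B) \<Longrightarrow> {b. f b \<noteq> \<zero>} \<subseteq> B"
  by (auto simp: free_module_carrier)

lemma free_outside: "f \<in> carrier (free B) \<Longrightarrow> b \<notin> B \<Longrightarrow> f b = \<zero>"
  by (auto simp: free_module_carrier)

lemma free_mono: "B \<subseteq> C \<Longrightarrow> f \<in> carrier (free B) \<Longrightarrow> f \<in> carrier (free C)"
  by (auto simp: free_module_carrier)

lemma basis_elem_carrier [simp]: "b \<in> B \<Longrightarrow> basis_elem R b \<in> carrier (free B)"
  by (rule free_carrierI[of _ _ "{b}"]) (auto simp: basis_elem_def split: if_splits)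

lemma free_zero_closed [simp]: "(\<lambda>_. \<zero>) \<in> carrier (free B)"
  by (simp add: free_module_carrier)

lemma free_add_closed:
  assumes "f \<in> carrier (free B)" "g \<in> carrier (free B)"
  shows "(\<lambda>b. f b \<oplus> g b) \<in> carrier (free B)"
  by (rule free_carrierI[of _ _ "{b. f b \<noteq> \<zero>} \<union> {b. g b \<noteq> \<zero>}"])
    (use assms free_support[OF assms(1)] free_support[OF assms(2)] in auto)

lemma free_smult_closed:
  assumes "f \<in> carrier (free B)" "c \<in> carrier R"
  shows "(\<lambda>b. c \<otimes> f b) \<in> carrier (free B)"
  by (rule free_carrierI[of _ _ "{b. f b \<noteq> \<zero>}"])
    (use assms free_support[OF assms(1)] in auto)

lemma free_vectorspace: "vectorspace R (free B)"
proof (rule vs_criteria)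
  show "\<forall>v\<in>carrier (free B). \<exists>w\<in>carrier (free B). v \<oplus>\<^bsub>free B\<^esub> w = \<zero>\<^bsub>free B\<^esub>"
  proof
    fix v assume v: "v \<in> carrier (free B)"
    have "(\<lambda>b. (\<ominus> \<one>) \<otimes> v b) \<in> carrier (free B)" by (rule free_smult_closed) (use v in auto)
    moreover have "v b \<oplus> (\<ominus> \<one>) \<otimes> v b = \<zero>" for b
      using v by (simp add: l_minus r_neg)
    ultimately show "\<exists>w\<in>carrier (free B). v \<oplus>\<^bsub>free B\<^esub> w = \<zero>\<^bsub>free B\<^esub>"
      by (intro bexI[of _ "\<lambda>b. (\<ominus> \<one>) \<otimes> v b"]) auto
  qed
  show "\<zero>\<^bsub>free B\<^esub> \<in> carrier (free B)" by (auto simp: free_module_carrier)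
qed (auto simp: free_add_closed free_smult_closed field_axioms fun_eq_iff
    a_ac m_assoc l_distr r_distr)

lemma free_update_split:
  assumes "f \<in> carrier (free B)" "b \<in> B"
  shows "f = (\<lambda>x. if x = b then \<zero> else f x) \<oplus>\<^bsub>free B\<^esub> (f b \<odot>\<^bsub>free B\<^esub> basis_elem R b)"
    and "(\<lambda>x. if x = b then \<zero> else f x) \<in> carrier (free B)"
  using assms free_support[OF assms(1)]
  by (auto simp: basis_elem_def fun_eq_iff split: if_splits intro!: free_carrierI[of _ _ "{b. f b \<noteq> \<zero>}"])

text \<open>
  An element is peeled off one support point at a time by \<open>free_update_split\<close>.
\<close>

lemma free_generated:
  assumes H: "submodule R H (free B)" and gen: "\<And>b. b \<in> B \<Longrightarrow> basis_elem R b \<in> H"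
    and f: "f \<in> carrier (free B)"
  shows "f \<in> H"
proof -
  interpret H: submodule R H "free B" by fact
  have "f \<in> H" if "finite F" "F \<subseteq> B" "\<And>b. f b \<noteq> \<zero> \<Longrightarrow> b \<in> F" "f \<in> carrier (free B)" for F f
    using that
  proof (induction F arbitrary: f rule: finite_induct)
    case empty
    then have "f = \<zero>\<^bsub>free B\<^esub>" by (auto simp: fun_eq_iff)
    then show ?case using H.zero_closed by simp
  next
    case (insert b F)
    have bB: "b \<in> B" using insert by auto
    note s = free_update_split[OF insert.prems(3) bB]
    have "(\<lambda>x. if x = b then \<zero> else f x) \<in> H"
      by (rule insert.IH) (use insert.prems s(2) in \<open>auto split: if_splits\<close>)
    then have "(\<lambda>x. if x = b then \<zero> else f x) \<oplus>\<^bsub>free B\<^esub> (f b \<odot>\<^bsub>free B\<^esub> basis_elem R b) \<in> H"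
      by (rule H.m_closed) (rule H.smult_closed[OF _ gen[OF bB]], use insert.prems in simp)
    then show ?case by (subst s(1))
  qed
  from this[OF free_support[OF f] _ f] show ?thesis by simp
qed

lemma free_hom_eqI:
  assumes "vectorspace R W" "T \<in> module_hom R (free B) W" "U \<in> module_hom R (free B) W"
    and "\<And>b. b \<in> B \<Longrightarrow> T (basis_elem R b) = U (basis_elem R b)" "f \<in> carrier (free B)"
  shows "T f = U f"
  using free_generated[OF equalizer_submodule[OF free_vectorspace assms(1,2,3)]] assms by auto

lemma free_ext_superset:
  assumes W: "vectorspace R W" and h: "\<And>b. b \<in> B \<Longrightarrow> h b \<in> carrier W"
    and f: "f \<in> carrier (free B)" and F: "finite F" "F \<subseteq> B" "{b. f b \<noteq> \<zero>} \<subseteq> F"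
  shows "free_ext R W h f = (\<Oplus>\<^bsub>W\<^esub> b \<in> F. f b \<odot>\<^bsub>W\<^esub> h b)"
proof -
  interpret W: vectorspace R W by fact
  show ?thesis unfolding free_ext_def
    by (rule W.M.add.finprod_mono_neutral_cong_left) (use assms in auto)
qed

lemma free_ext_hom:
  assumes W: "vectorspace R W" and h: "\<And>b. b \<in> B \<Longrightarrow> h b \<in> carrier W"
  shows "free_ext R W h \<in> module_hom R (free B) W"
proof (rule module_homI)
  interpret W: vectorspace R W by fact
  interpret F: vectorspace R "free B" by (rule free_vectorspace)
  show "free_ext R W h f \<in> carrier W" if "f \<in> carrier (free B)" for f
    unfolding free_ext_def using that h free_support(2)[OF that] by (auto intro!: W.M.finsum_closed)
  fix f g assume f: "f \<in> carrier (free B)" and g: "g \<in> carrier (free B)"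
  let ?F = "{b. f b \<noteq> \<zero>} \<union> {b. g b \<noteq> \<zero>}"
  have F: "finite ?F" "?F \<subseteq> B" using free_support[OF f] free_support[OF g] by auto
  have hF: "\<And>b. b \<in> ?F \<Longrightarrow> h b \<in> carrier W" using F h by blast
  have fg: "f \<oplus>\<^bsub>free B\<^esub> g \<in> carrier (free B)" using f g by (rule F.M.add.m_closed)
  have "free_ext R W h (f \<oplus>\<^bsub>free B\<^esub> g) = (\<Oplus>\<^bsub>W\<^esub> b \<in> ?F. (f b \<oplus> g b) \<odot>\<^bsub>W\<^esub> h b)"
    by (subst free_ext_superset[OF W h fg F]) auto
  also have "\<dots> = (\<Oplus>\<^bsub>W\<^esub> b \<in> ?F. f b \<odot>\<^bsub>W\<^esub> h b \<oplus>\<^bsub>W\<^esub> g b \<odot>\<^bsub>W\<^esub> h b)"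
    by (rule W.M.finsum_cong') (use f g hF in \<open>auto simp: W.smult_l_distr\<close>)
  also have "\<dots> = (\<Oplus>\<^bsub>W\<^esub> b \<in> ?F. f b \<odot>\<^bsub>W\<^esub> h b) \<oplus>\<^bsub>W\<^esub> (\<Oplus>\<^bsub>W\<^esub> b \<in> ?F. g b \<odot>\<^bsub>W\<^esub> h b)"
    by (rule W.M.finsum_addf) (use f g hF in auto)
  also have "\<dots> = free_ext R W h f \<oplus>\<^bsub>W\<^esub> free_ext R W h g"
    using free_ext_superset[OF W h f F] free_ext_superset[OF W h g F] by auto
  finally show "free_ext R W h (f \<oplus>\<^bsub>free B\<^esub> g) = free_ext R W h f \<oplus>\<^bsub>W\<^esub> free_ext R W h g" .
next
  interpret W: vectorspace R W by fact
  interpret F: vectorspace R "free B" by (rule free_vectorspace)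
  fix c f assume c: "c \<in> carrier R" and f: "f \<in> carrier (free B)"
  let ?F = "{b. f b \<noteq> \<zero>}"
  have F: "finite ?F" "?F \<subseteq> B" using free_support[OF f] by auto
  have hF: "\<And>b. b \<in> ?F \<Longrightarrow> h b \<in> carrier W" using F h by blast
  have cf: "c \<odot>\<^bsub>free B\<^esub> f \<in> carrier (free B)" using c f by (rule F.smult_closed)
  have "free_ext R W h (c \<odot>\<^bsub>free B\<^esub> f) = (\<Oplus>\<^bsub>W\<^esub> b \<in> ?F. (c \<otimes> f b) \<odot>\<^bsub>W\<^esub> h b)"
    by (subst free_ext_superset[OF W h cf F]) (use c in auto)
  also have "\<dots> = (\<Oplus>\<^bsub>W\<^esub> b \<in> ?F. c \<odot>\<^bsub>W\<^esub> (f b \<odot>\<^bsub>W\<^esub> h b))"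
    by (rule W.M.finsum_cong') (use c f hF in \<open>auto simp: W.smult_assoc1\<close>)
  also have "\<dots> = c \<odot>\<^bsub>W\<^esub> (\<Oplus>\<^bsub>W\<^esub> b \<in> ?F. f b \<odot>\<^bsub>W\<^esub> h b)"
    by (rule W.finsum_smult_ldistr[symmetric]) (use c f F hF in auto)
  finally show "free_ext R W h (c \<odot>\<^bsub>free B\<^esub> f) = c \<odot>\<^bsub>W\<^esub> free_ext R W h f"
    by (simp add: free_ext_def)
qed

lemma free_ext_basis_elem:
  assumes W: "vectorspace R W" and h: "h b \<in> carrier W"
  shows "free_ext R W h (basis_elem R b) = h b"
proof -
  interpret W: vectorspace R W by fact
  have "free_ext R W h (basis_elem R b) = (\<Oplus>\<^bsub>W\<^esub> x \<in> {b}. basis_elem R b x \<odot>\<^bsub>W\<^esub> h x)"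
    by (rule free_ext_superset[OF W, of "{b}"]) (use h in \<open>auto\<close>, auto simp: basis_elem_def split: if_splits)
  then show ?thesis using h by (simp add: basis_elem_def)
qed

text \<open>
  This turns an identity between vectors into one between scalars, coordinate by coordinate.
\<close>

lemma free_finsum_apply:
  assumes "finite F" "\<And>i. i \<in> F \<Longrightarrow> f i \<in> carrier (free B)"
  shows "(\<Oplus>\<^bsub>free B\<^esub> i \<in> F. f i) q = (\<Oplus> i \<in> F. f i q)"
proof -
  interpret F: vectorspace R "free B" by (rule free_vectorspace)
  show ?thesis using assms
  proof (induction F rule: finite_induct)
    case empty then show ?case by simp
  next
    case (insert i F)
    have "(\<Oplus>\<^bsub>free B\<^esub> i \<in> insert i F. f i) = f i \<oplus>\<^bsub>free B\<^esub> (\<Oplus>\<^bsub>free B\<^esub> i \<in> F. f i)"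
      by (rule F.M.finsum_insert) (use insert in auto)
    moreover have "(\<Oplus> i \<in> insert i F. f i q) = f i q \<oplus> (\<Oplus> i \<in> F. f i q)"
      by (rule finsum_insert) (use insert in \<open>auto intro: free_carrier_app\<close>)
    ultimately show ?case using insert by simp
  qed
qed

lemma free_dim:
  assumes fin: "finite B"
  shows "vectorspace.fin_dim R (free B)" "vectorspace.dim R (free B) = card B"
proof -
  interpret F: vectorspace R "free B" by (rule free_vectorspace)
  let ?d = "basis_elem R"
  have inj: "inj_on ?d B" by (rule inj_onI) (auto simp: basis_elem_def fun_eq_iff split: if_splits)
  have sub: "?d ` B \<subseteq> carrier (free B)" by auto
  have gen: "F.gen_set (?d ` B)"
    using free_generated[OF F.span_is_submodule[OF sub]] F.in_own_span[OF sub] F.span_is_subset2[OF sub]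
    by blast
  have li: "F.lin_indpt (?d ` B)"
  proof (rule F.finite_lin_indpt2)
    fix a assume a: "a \<in> ?d ` B \<rightarrow> carrier R" and z: "F.lincomb a (?d ` B) = \<zero>\<^bsub>free B\<^esub>"
    have "a (?d b) = \<zero>" if b: "b \<in> B" for b
    proof -
      have "F.lincomb a (?d ` B) b = (\<Oplus> v \<in> ?d ` B. (a v \<odot>\<^bsub>free B\<^esub> v) b)"
        unfolding F.lincomb_def
        by (rule free_finsum_apply) (use a fin sub in \<open>auto simp del: free_module_simps\<close>)
      also have "\<dots> = (\<Oplus> v \<in> {?d b}. a v \<otimes> v b)"
      proof (rule add.finprod_mono_neutral_cong_right)
        have *: "a v \<in> carrier R" "v b \<in> carrier R" if "v \<in> ?d ` B" for v
          using a that by (auto simp: basis_elem_def)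
        show "(\<lambda>v. (a v \<odot>\<^bsub>free B\<^esub> v) b) \<in> ?d ` B \<rightarrow> carrier R" using * by auto
        show "(a v \<odot>\<^bsub>free B\<^esub> v) b = \<zero>" if "v \<in> ?d ` B - {?d b}" for v
          using that * by (auto simp: basis_elem_def)
      qed (use b fin in auto)
      also have "\<dots> = a (?d b)" using a b by (simp add: basis_elem_def Pi_iff)
      finally show ?thesis using z by simp
    qed
    then show "\<forall>v\<in>?d ` B. a v = \<zero>" by auto
  qed (use fin sub in auto)
  have basis: "F.basis (?d ` B)" using gen li sub by (auto simp: F.basis_def)
  then show "F.dim = card B" using F.dim_basis[of "?d ` B"] fin inj by (simp add: card_image)
  show "F.fin_dim" unfolding F.fin_dim_def using gen fin sub by blast
qed

end

section \<open>Quotients and tensor products\<close>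

text \<open>
  The map that \<open>T\<close> induces on cosets; it is meaningful when \<open>T\<close> is constant on each of them.
\<close>

definition descend :: "('a \<Rightarrow> 'b) \<Rightarrow> 'a set \<Rightarrow> 'b" where
  "descend T t = T (SOME x. x \<in> t)"

locale vector_quotient = V: vectorspace K M for K and M (structure) +
  fixes N
  assumes sub: "submodule K N M"
begin

sublocale N: submodule K N M by (rule sub)

abbreviation "proj x \<equiv> N +>\<^bsub>M\<^esub> x"
abbreviation "Q \<equiv> quot_module M N"

lemma N_minus_closed: assumes "x \<in> N" shows "\<ominus>\<^bsub>M\<^esub> x \<in> N"
proof -
  have x: "x \<in> carrier M" using assms N.subset by auto
  have "(\<ominus>\<^bsub>K\<^esub> \<one>\<^bsub>K\<^esub>) \<odot>\<^bsub>M\<^esub> x \<in> N" using assms by (intro N.smult_closed) auto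
  then show ?thesis using x by (simp add: V.smult_l_minus)
qed

lemma N_subgroup: "abelian_subgroup N M"
proof (rule abelian_subgroupI3)
  show "additive_subgroup N M"
    by (rule additive_subgroup.intro, rule V.M.add.subgroupI)
      (use N.subset N_minus_closed N.zero_closed N.m_closed in \<open>auto simp flip: a_inv_def simp del: N.zero_closed\<close>)
qed (rule V.M.abelian_group_axioms)

sublocale G: abelian_subgroup N M by (rule N_subgroup)

lemma proj_mem: "x \<in> carrier M \<Longrightarrow> y \<in> proj x \<longleftrightarrow> y \<in> carrier M \<and> y \<ominus>\<^bsub>M\<^esub> x \<in> N"
  using G.a_rcos_module G.a_elemrcos_carrier by (metis a_minus_def)

lemma proj_self: "x \<in> carrier M \<Longrightarrow> x \<in> proj x"
  by (rule G.a_rcos_self)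

lemma proj_eq_iff:
  assumes "x \<in> carrier M" "y \<in> carrier M"
  shows "proj x = proj y \<longleftrightarrow> x \<ominus>\<^bsub>M\<^esub> y \<in> N"
  using assms proj_mem[of y x] proj_self[of x] G.a_repr_independence'[of x y] by metis

lemma quot_carrier: "carrier Q = proj ` carrier M"
  by (auto simp: quot_module_def FactRing_simps)

lemma quot_carrierE:
  assumes "t \<in> carrier Q" obtains x where "x \<in> carrier M" "t = proj x"
  using assms by (auto simp: quot_carrier)

lemma quot_mem:
  assumes t: "t \<in> carrier Q" and x: "x \<in> t"
  shows "x \<in> carrier M" "t = proj x"
proof -
  obtain y where y: "y \<in> carrier M" "t = proj y" using t by (rule quot_carrierE)
  show "x \<in> carrier M" using x y proj_mem by blast
  show "t = proj x" using x y G.a_repr_independence' by blast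
qed

lemma quot_add:
  "x \<in> carrier M \<Longrightarrow> y \<in> carrier M \<Longrightarrow> proj x \<oplus>\<^bsub>Q\<^esub> proj y = proj (x \<oplus>\<^bsub>M\<^esub> y)"
  by (simp add: quot_module_def FactRing_simps G.a_rcos_sum)

lemma quot_zero: "\<zero>\<^bsub>Q\<^esub> = proj \<zero>\<^bsub>M\<^esub>"
  using V.M.a_coset_join2[of "\<zero>\<^bsub>M\<^esub>" N] G.a_subgroup by (simp add: quot_module_def FactRing_def)

lemma quot_smult:
  assumes c: "c \<in> carrier K" and x: "x \<in> carrier M"
  shows "c \<odot>\<^bsub>Q\<^esub> proj x = proj (c \<odot>\<^bsub>M\<^esub> x)"
proof -
  have "proj (c \<odot>\<^bsub>M\<^esub> y) = proj (c \<odot>\<^bsub>M\<^esub> x)" if "y \<in> proj x" for y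
  proof -
    have y: "y \<in> carrier M" "y \<ominus>\<^bsub>M\<^esub> x \<in> N" using that proj_mem x by auto
    have "c \<odot>\<^bsub>M\<^esub> (y \<ominus>\<^bsub>M\<^esub> x) \<in> N" using y c by blast
    moreover have "c \<odot>\<^bsub>M\<^esub> (y \<ominus>\<^bsub>M\<^esub> x) = (c \<odot>\<^bsub>M\<^esub> y) \<ominus>\<^bsub>M\<^esub> (c \<odot>\<^bsub>M\<^esub> x)"
      using c x y by (simp add: a_minus_def V.smult_r_distr V.smult_r_minus)
    ultimately show ?thesis using proj_eq_iff[of "c \<odot>\<^bsub>M\<^esub> y" "c \<odot>\<^bsub>M\<^esub> x"] c x y by simp
  qed
  then have "(\<Union>y\<in>proj x. proj (c \<odot>\<^bsub>M\<^esub> y)) = (\<Union>y\<in>proj x. proj (c \<odot>\<^bsub>M\<^esub> x))" by simp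
  also have "\<dots> = proj (c \<odot>\<^bsub>M\<^esub> x)" using proj_self[OF x] by blast
  finally show ?thesis by (simp add: quot_module_def)
qed

lemma proj_closed: "x \<in> carrier M \<Longrightarrow> proj x \<in> carrier Q"
  by (auto simp: quot_carrier)

lemma quot_vectorspace: "vectorspace K Q"
proof (rule vs_criteria)
  show "\<forall>v\<in>carrier Q. \<exists>w\<in>carrier Q. v \<oplus>\<^bsub>Q\<^esub> w = \<zero>\<^bsub>Q\<^esub>"
  proof
    fix v assume "v \<in> carrier Q"
    then obtain x where x: "x \<in> carrier M" "v = proj x" by (rule quot_carrierE)
    then show "\<exists>w\<in>carrier Q. v \<oplus>\<^bsub>Q\<^esub> w = \<zero>\<^bsub>Q\<^esub>"
      by (intro bexI[of _ "proj (\<ominus>\<^bsub>M\<^esub> x)"]) (auto simp: quot_add quot_zero V.M.r_neg proj_closed)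
  qed
qed (auto simp: V.field_axioms quot_carrier quot_add quot_zero quot_smult V.M.a_assoc
    V.smult_assoc1 V.smult_l_distr V.smult_r_distr V.M.a_ac)

lemma proj_hom: "proj \<in> module_hom K M Q"
  by (rule module_homI) (auto simp: proj_closed quot_add quot_smult)

lemma quot_hom_eqI:
  assumes "vectorspace K W" "T \<in> module_hom K Q W" "U \<in> module_hom K Q W"
    and "\<And>x. x \<in> carrier M \<Longrightarrow> T (proj x) = U (proj x)" "t \<in> carrier Q"
  shows "T t = U t"
  using assms by (auto elim!: quot_carrierE)

lemma hom_const_on_coset:
  assumes W: "vectorspace K W" and T: "T \<in> module_hom K M W" and null: "\<And>n. n \<in> N \<Longrightarrow> T n = \<zero>\<^bsub>W\<^esub>"
    and x: "x \<in> carrier M" and y: "y \<in> proj x"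
  shows "T y = T x"
proof -
  interpret T: linear_map K M W T by (rule linear_mapI) (rule V.vectorspace_axioms, fact+)
  have yc: "y \<in> carrier M" and d: "y \<ominus>\<^bsub>M\<^esub> x \<in> N" using proj_mem x y by auto
  have "T y = T ((y \<ominus>\<^bsub>M\<^esub> x) \<oplus>\<^bsub>M\<^esub> x)"
    using x yc by (simp add: a_minus_def V.M.a_assoc V.M.l_neg)
  also have "\<dots> = T x" using null[OF d] x yc by simp
  finally show ?thesis .
qed

lemma descend_mem:
  assumes W: "vectorspace K W" and T: "T \<in> module_hom K M W" and null: "\<And>n. n \<in> N \<Longrightarrow> T n = \<zero>\<^bsub>W\<^esub>"
    and t: "t \<in> carrier Q" and x: "x \<in> t"
  shows "descend T t = T x"
proof -
  have "t = proj x" "x \<in> carrier M" using quot_mem t x by auto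
  moreover have "(SOME x. x \<in> t) \<in> t" using x by (rule someI)
  ultimately show ?thesis unfolding descend_def
    using hom_const_on_coset[OF W T null] by metis
qed

lemma descend_proj:
  assumes W: "vectorspace K W" and T: "T \<in> module_hom K M W" and null: "\<And>n. n \<in> N \<Longrightarrow> T n = \<zero>\<^bsub>W\<^esub>"
    and x: "x \<in> carrier M"
  shows "descend T (proj x) = T x"
  using descend_mem[OF W T null proj_closed[OF x] proj_self[OF x]] .

lemma descend_hom:
  assumes W: "vectorspace K W" and T: "T \<in> module_hom K M W" and null: "\<And>n. n \<in> N \<Longrightarrow> T n = \<zero>\<^bsub>W\<^esub>"
  shows "descend T \<in> module_hom K Q W"
proof (rule module_homI)
  note d = descend_proj[OF W T null]
  fix t assume "t \<in> carrier Q"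
  then obtain x where x: "x \<in> carrier M" "t = proj x" by (rule quot_carrierE)
  then show "descend T t \<in> carrier W" using d module_hom_mem[OF T] by simp
  show "descend T (c \<odot>\<^bsub>Q\<^esub> t) = c \<odot>\<^bsub>W\<^esub> descend T t" if "c \<in> carrier K" for c
    using x that by (simp add: d quot_smult module_hom_smult[OF T])
  fix u assume "u \<in> carrier Q"
  then obtain y where "y \<in> carrier M" "u = proj y" by (rule quot_carrierE)
  then show "descend T (t \<oplus>\<^bsub>Q\<^esub> u) = descend T t \<oplus>\<^bsub>W\<^esub> descend T u"
    using x by (simp add: d quot_add module_hom_add[OF T])
qed

end

text \<open>
  The argument is a pair because maps of this kind serve as values on the basis \<open>M \<times> N\<close> of the free module
  that is used to construct the tensor product.
\<close>

definition bilinear_on ::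
  "('k, 'r) ring_scheme \<Rightarrow> ('k, 'a, 's) module_scheme \<Rightarrow> ('k, 'b, 't) module_scheme
    \<Rightarrow> ('k, 'c, 'u) module_scheme \<Rightarrow> ('a \<times> 'b \<Rightarrow> 'c) \<Rightarrow> bool" where
  "bilinear_on K M N W h \<longleftrightarrow>
    (\<forall>y\<in>carrier N. (\<lambda>x. h (x, y)) \<in> module_hom K M W) \<and>
    (\<forall>x\<in>carrier M. (\<lambda>y. h (x, y)) \<in> module_hom K N W)"

lemma bilinear_onD:
  assumes "bilinear_on K M N W h"
  shows "y \<in> carrier N \<Longrightarrow> (\<lambda>x. h (x, y)) \<in> module_hom K M W"
    and "x \<in> carrier M \<Longrightarrow> (\<lambda>y. h (x, y)) \<in> module_hom K N W"
  using assms by (auto simp: bilinear_on_def)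

lemma bilinear_on_comp:
  assumes "bilinear_on K M N W h" "f \<in> module_hom K M' M" "g \<in> module_hom K N' N"
  shows "bilinear_on K M' N' W (\<lambda>p. h (f (fst p), g (snd p)))"
  using assms unfolding bilinear_on_def
  by (auto intro: module_hom_comp[of f] module_hom_comp[of g] simp: module_hom_mem)

lemma bilinear_on_hom:
  assumes "bilinear_on K M N W h" "T \<in> module_hom K W W'"
  shows "bilinear_on K M N W' (\<lambda>p. T (h p))"
  using assms unfolding bilinear_on_def by (auto intro: module_hom_comp[of _ K _ W T])

text \<open>
  The linear map on the tensor product that corresponds to a bilinear map.
\<close>

definition tensor_lift ::
  "('k, 'r) ring_scheme \<Rightarrow> ('k, 'c, 'u) module_scheme \<Rightarrow> ('a \<times> 'b \<Rightarrow> 'c)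
    \<Rightarrow> ('a \<times> 'b \<Rightarrow> 'k) set \<Rightarrow> 'c" where
  "tensor_lift K W h = descend (free_ext K W h)"

locale tensor_product = M: vectorspace K M + N: vectorspace K N for K and M and N
begin

abbreviation "F \<equiv> free_module K (carrier M \<times> carrier N)"
abbreviation "T \<equiv> tensor_module K M N"
abbreviation "pure \<equiv> pure_tensor K M N"

sublocale F: vectorspace K F by (rule M.free_vectorspace)

lemma relations_carrier: "tensor_relations K M N \<subseteq> carrier F"
  unfolding tensor_relations_def Let_def
  by (auto simp del: free_module_simps intro!: F.M.minus_closed F.M.a_closed F.smult_closed M.basis_elem_carrier)

lemma null_submodule: "submodule K (tensor_null K M N) F"
  unfolding tensor_null_def by (rule F.span_is_submodule[OF relations_carrier])

sublocale Q: vector_quotient K F "tensor_null K M N"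
  by (rule vector_quotient.intro[OF F.vectorspace_axioms vector_quotient_axioms.intro[OF null_submodule]])

lemma tensor_eq: "T = Q.Q"
  by (simp add: tensor_module_def)

lemma tensor_vectorspace: "vectorspace K T"
  using Q.quot_vectorspace by (simp add: tensor_eq)

lemma pure_eq: "pure x y = Q.proj (basis_elem K (x, y))"
  by (simp add: pure_tensor_def)

lemma relation_null: "r \<in> tensor_relations K M N \<Longrightarrow> r \<in> tensor_null K M N"
  unfolding tensor_null_def using F.in_own_span[OF relations_carrier] by blast

lemma pure_bilinear: "bilinear_on K M N T (\<lambda>p. pure (fst p) (snd p))"
  unfolding bilinear_on_def fst_conv snd_conv
proof (intro conjI ballI module_homI)
  fix x y assume xy: "x \<in> carrier M" "y \<in> carrier N"
  then show "pure x y \<in> carrier T" "pure x y \<in> carrier T"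
    by (simp_all add: pure_eq tensor_eq Q.proj_closed del: free_module_simps)
  fix c assume c: "c \<in> carrier K"
  have "basis_elem K (c \<odot>\<^bsub>M\<^esub> x, y) \<ominus>\<^bsub>F\<^esub> (c \<odot>\<^bsub>F\<^esub> basis_elem K (x, y)) \<in> tensor_null K M N"
    by (rule relation_null) (use xy c in \<open>unfold tensor_relations_def Let_def, blast\<close>)
  then show "pure (c \<odot>\<^bsub>M\<^esub> x) y = c \<odot>\<^bsub>T\<^esub> pure x y"
    unfolding pure_eq tensor_eq using xy c
    by (simp add: Q.quot_smult Q.proj_eq_iff M.basis_elem_carrier del: free_module_simps)
  have "basis_elem K (x, c \<odot>\<^bsub>N\<^esub> y) \<ominus>\<^bsub>F\<^esub> (c \<odot>\<^bsub>F\<^esub> basis_elem K (x, y)) \<in> tensor_null K M N"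
    by (rule relation_null) (use xy c in \<open>unfold tensor_relations_def Let_def, blast\<close>)
  then show "pure x (c \<odot>\<^bsub>N\<^esub> y) = c \<odot>\<^bsub>T\<^esub> pure x y"
    unfolding pure_eq tensor_eq using xy c
    by (simp add: Q.quot_smult Q.proj_eq_iff M.basis_elem_carrier del: free_module_simps)
next
  fix x x' y assume xy: "x \<in> carrier M" "x' \<in> carrier M" "y \<in> carrier N"
  have "basis_elem K (x \<oplus>\<^bsub>M\<^esub> x', y) \<ominus>\<^bsub>F\<^esub> (basis_elem K (x, y) \<oplus>\<^bsub>F\<^esub> basis_elem K (x', y)) \<in> tensor_null K M N"
    by (rule relation_null) (use xy in \<open>unfold tensor_relations_def Let_def, blast\<close>)
  then show "pure (x \<oplus>\<^bsub>M\<^esub> x') y = pure x y \<oplus>\<^bsub>T\<^esub> pure x' y"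
    unfolding pure_eq tensor_eq using xy
    by (simp add: Q.quot_add Q.proj_eq_iff M.basis_elem_carrier del: free_module_simps)
next
  fix x y y' assume xy: "x \<in> carrier M" "y \<in> carrier N" "y' \<in> carrier N"
  have "basis_elem K (x, y \<oplus>\<^bsub>N\<^esub> y') \<ominus>\<^bsub>F\<^esub> (basis_elem K (x, y) \<oplus>\<^bsub>F\<^esub> basis_elem K (x, y')) \<in> tensor_null K M N"
    by (rule relation_null) (use xy in \<open>unfold tensor_relations_def Let_def, blast\<close>)
  then show "pure x (y \<oplus>\<^bsub>N\<^esub> y') = pure x y \<oplus>\<^bsub>T\<^esub> pure x y'"
    unfolding pure_eq tensor_eq using xy
    by (simp add: Q.quot_add Q.proj_eq_iff M.basis_elem_carrier del: free_module_simps)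
qed

lemma tensor_hom_eqI:
  assumes W: "vectorspace K W" and f: "f \<in> module_hom K T W" and g: "g \<in> module_hom K T W"
    and eq: "\<And>x y. x \<in> carrier M \<Longrightarrow> y \<in> carrier N \<Longrightarrow> f (pure x y) = g (pure x y)"
    and t: "t \<in> carrier T"
  shows "f t = g t"
proof (rule Q.quot_hom_eqI[OF W])
  show "f \<in> module_hom K Q.Q W" "g \<in> module_hom K Q.Q W" "t \<in> carrier Q.Q"
    using f g t by (simp_all add: tensor_eq)
  then have "(\<lambda>x. f (Q.proj x)) \<in> module_hom K F W" "(\<lambda>x. g (Q.proj x)) \<in> module_hom K F W"
    using module_hom_comp[OF Q.proj_hom] by blast+
  then show "f (Q.proj x) = g (Q.proj x)" if "x \<in> carrier F" for x
    by (rule M.free_hom_eqI[OF W]) (use eq that in \<open>auto simp: pure_eq\<close>)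
qed

text \<open>
  Each family of defining relations of the tensor product is sent to zero by one of the laws of
  bilinearity, and the relations span the submodule that is factored out.
\<close>

lemma bilinear_ext:
  assumes W: "vectorspace K W" and h: "bilinear_on K M N W h"
  shows "free_ext K W h \<in> module_hom K F W"
    and "n \<in> tensor_null K M N \<Longrightarrow> free_ext K W h n = \<zero>\<^bsub>W\<^esub>"
proof -
  interpret W: vectorspace K W by fact
  have hc: "h p \<in> carrier W" if "p \<in> carrier M \<times> carrier N" for p
    using that module_hom_mem[OF bilinear_onD(1)[OF h]] by (cases p) auto
  show hom: "free_ext K W h \<in> module_hom K F W"
    by (rule M.free_ext_hom[OF W hc])
  interpret e: linear_map K F W "free_ext K W h"
    by (rule linear_mapI[OF F.vectorspace_axioms W hom])
  have e: "free_ext K W h (basis_elem K p) = h p" if "p \<in> carrier M \<times> carrier N" for p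
    by (rule M.free_ext_basis_elem[OF W]) (rule hc[OF that])
  have sub: "r \<in> e.ker" if r: "r \<in> tensor_relations K M N" for r
  proof -
    have "free_ext K W h r = \<zero>\<^bsub>W\<^esub>"
      using r unfolding tensor_relations_def Let_def
      by (auto simp del: free_module_simps simp: e hc W.M.r_neg a_minus_def
          module_hom_add[OF bilinear_onD(1)[OF h]] module_hom_add[OF bilinear_onD(2)[OF h]]
          module_hom_smult[OF bilinear_onD(1)[OF h]] module_hom_smult[OF bilinear_onD(2)[OF h]])
    then show ?thesis using r relations_carrier by (auto simp: e.ker_def)
  qed
  have "tensor_null K M N \<subseteq> e.ker"
    unfolding tensor_null_def by (rule F.span_is_subset[OF _ e.ker_is_submodule]) (use sub in blast)
  then show "free_ext K W h n = \<zero>\<^bsub>W\<^esub>" if "n \<in> tensor_null K M N"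
    using that by (auto simp: e.ker_def)
qed

text \<open>
  The universal property of the tensor product, together with the value on a tensor that is given by an
  arbitrary representative \<open>f\<close>.
\<close>

lemma tensor_lift:
  assumes W: "vectorspace K W" and h: "bilinear_on K M N W h"
  shows lift_hom: "tensor_lift K W h \<in> module_hom K T W"
    and lift_mem: "t \<in> carrier T \<Longrightarrow> f \<in> t \<Longrightarrow> tensor_lift K W h t = free_ext K W h f"
    and lift_pure: "x \<in> carrier M \<Longrightarrow> y \<in> carrier N \<Longrightarrow> tensor_lift K W h (pure x y) = h (x, y)"
proof -
  note e = bilinear_ext[OF W h]
  show "tensor_lift K W h \<in> module_hom K T W"
    unfolding tensor_lift_def tensor_eq by (rule Q.descend_hom[OF W e])
  show "t \<in> carrier T \<Longrightarrow> f \<in> t \<Longrightarrow> tensor_lift K W h t = free_ext K W h f"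
    unfolding tensor_lift_def tensor_eq by (rule Q.descend_mem[OF W e])
  assume xy: "x \<in> carrier M" "y \<in> carrier N"
  have "tensor_lift K W h (pure x y) = free_ext K W h (basis_elem K (x, y))"
    unfolding tensor_lift_def pure_eq by (rule Q.descend_proj[OF W e]) (use xy in auto)
  also have "\<dots> = h (x, y)"
    by (rule M.free_ext_basis_elem[OF W]) (use xy module_hom_mem[OF bilinear_onD(1)[OF h]] in auto)
  finally show "tensor_lift K W h (pure x y) = h (x, y)" .
qed

end


section \<open>Coproducts and central tensors\<close>

lemma linear_inj_onI:
  assumes V: "vectorspace K V" and W: "vectorspace K W" and T: "T \<in> module_hom K V W"
    and ker: "\<And>x. x \<in> carrier V \<Longrightarrow> T x = \<zero>\<^bsub>W\<^esub> \<Longrightarrow> x = \<zero>\<^bsub>V\<^esub>"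
  shows "inj_on T (carrier V)"
proof -
  interpret linear_map K V W T by (rule linear_mapI) fact+
  show ?thesis by (rule Ke0_imp_inj) (use ker in \<open>auto simp: ker_def\<close>)
qed

text \<open>
  A unital algebra as the bimodule action sees it: a vector space with a bilinear product and a
  two-sided unit.
\<close>

locale algebra_over = A: vectorspace K A for K and A (structure) +
  assumes mult_left_hom: "a \<in> carrier A \<Longrightarrow> (\<lambda>x. a \<otimes> x) \<in> module_hom K A A"
    and mult_right_hom: "a \<in> carrier A \<Longrightarrow> (\<lambda>x. x \<otimes> a) \<in> module_hom K A A"
    and one_closed [simp]: "\<one> \<in> carrier A"
    and l_one [simp]: "x \<in> carrier A \<Longrightarrow> \<one> \<otimes> x = x"
    and r_one [simp]: "x \<in> carrier A \<Longrightarrow> x \<otimes> \<one> = x"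
begin

sublocale AA: tensor_product K A A by unfold_locales

sublocale T: vectorspace K AA.T by (rule AA.tensor_vectorspace)

abbreviation "act \<equiv> bimodule_action K A"

lemma mult_closed [simp]: "a \<in> carrier A \<Longrightarrow> x \<in> carrier A \<Longrightarrow> a \<otimes> x \<in> carrier A"
  using module_hom_mem[OF mult_left_hom] .

lemma act_bilinear:
  assumes "a \<in> carrier A" "d \<in> carrier A"
  shows "bilinear_on K A A AA.T (\<lambda>p. AA.pure (a \<otimes> fst p) (snd p \<otimes> d))"
  using bilinear_on_comp[OF AA.pure_bilinear mult_left_hom[OF assms(1)] mult_right_hom[OF assms(2)]]
  by simp

text \<open>
  The sum in the definition of the action does not depend on the representative, because it is the
  linear extension of a bilinear map; so the set whose element is taken is a singleton.
\<close>

lemma act_eq_lift: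
  assumes a: "a \<in> carrier A" and d: "d \<in> carrier A" and t: "t \<in> carrier AA.T"
  shows "act a t d = tensor_lift K AA.T (\<lambda>p. AA.pure (a \<otimes> fst p) (snd p \<otimes> d)) t"
proof -
  let ?h = "\<lambda>p. AA.pure (a \<otimes> fst p) (snd p \<otimes> d)"
  obtain f where "f \<in> t"
    using t AA.Q.proj_self by (auto elim!: AA.Q.quot_carrierE simp: AA.tensor_eq)
  moreover have "free_ext K AA.T ?h g = tensor_lift K AA.T ?h t" if "g \<in> t" for g
    using AA.lift_mem[OF T.vectorspace_axioms act_bilinear[OF a d] t that] by simp
  ultimately have "free_ext K AA.T ?h ` t = {tensor_lift K AA.T ?h t}" by auto
  then show ?thesis unfolding bimodule_action_def free_ext_def by simp
qed

lemma act_hom: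
  assumes "a \<in> carrier A" "d \<in> carrier A"
  shows "(\<lambda>t. act a t d) \<in> module_hom K AA.T AA.T"
proof -
  have "tensor_lift K AA.T (\<lambda>p. AA.pure (a \<otimes> fst p) (snd p \<otimes> d)) \<in> module_hom K AA.T AA.T"
    by (rule AA.lift_hom[OF T.vectorspace_axioms act_bilinear[OF assms]])
  then show ?thesis using act_eq_lift[OF assms] by (auto simp: module_hom_def)
qed

lemma act_pure:
  assumes "a \<in> carrier A" "d \<in> carrier A" "x \<in> carrier A" "y \<in> carrier A"
  shows "act a (AA.pure x y) d = AA.pure (a \<otimes> x) (y \<otimes> d)"
proof -
  have "AA.pure x y \<in> carrier AA.T"
    using assms module_hom_mem[OF bilinear_onD(1)[OF AA.pure_bilinear]] by fastforce
  then show ?thesis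
    using assms AA.lift_pure[OF T.vectorspace_axioms act_bilinear] by (simp add: act_eq_lift)
qed

abbreviation "coproducts \<equiv> nearly_frobenius_coproducts K A"

lemma coproductsD:
  assumes "D \<in> coproducts"
  shows "D \<in> module_hom K A AA.T" "D \<in> extensional (carrier A)"
    "\<And>a x d. a \<in> carrier A \<Longrightarrow> x \<in> carrier A \<Longrightarrow> d \<in> carrier A \<Longrightarrow> D (a \<otimes> x \<otimes> d) = act a (D x) d"
    "\<And>x. x \<in> carrier A \<Longrightarrow> D x \<in> carrier AA.T"
  using assms by (auto simp: nearly_frobenius_coproducts_def module_hom_def)

lemma zero_coproduct: "(\<lambda>x\<in>carrier A. \<zero>\<^bsub>AA.T\<^esub>) \<in> coproducts"
proof -
  have "act a \<zero>\<^bsub>AA.T\<^esub> d = \<zero>\<^bsub>AA.T\<^esub>" if "a \<in> carrier A" "d \<in> carrier A" for a d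
  proof -
    interpret linear_map K AA.T AA.T "\<lambda>t. act a t d"
      by (rule linear_mapI[OF T.vectorspace_axioms T.vectorspace_axioms act_hom[OF that]])
    show ?thesis by (rule f0_is_0)
  qed
  then show ?thesis by (auto simp: nearly_frobenius_coproducts_def module_hom_def)
qed

lemma add_coproduct:
  assumes f: "f \<in> coproducts" and g: "g \<in> coproducts"
  shows "(\<lambda>x\<in>carrier A. f x \<oplus>\<^bsub>AA.T\<^esub> g x) \<in> coproducts"
  unfolding nearly_frobenius_coproducts_def
  using coproductsD(3,4)[OF f] coproductsD(3,4)[OF g]
    module_hom_add[OF coproductsD(1)[OF f]] module_hom_add[OF coproductsD(1)[OF g]]
    module_hom_smult[OF coproductsD(1)[OF f]] module_hom_smult[OF coproductsD(1)[OF g]]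
    module_hom_add[OF act_hom]
  by (auto intro!: module_homI simp: T.smult_r_distr T.M.a_ac)

lemma smult_coproduct:
  assumes f: "f \<in> coproducts" and c: "c \<in> carrier K"
  shows "(\<lambda>x\<in>carrier A. c \<odot>\<^bsub>AA.T\<^esub> f x) \<in> coproducts"
  unfolding nearly_frobenius_coproducts_def
  using coproductsD(3,4)[OF f] c
    module_hom_add[OF coproductsD(1)[OF f]] module_hom_smult[OF coproductsD(1)[OF f]]
    module_hom_smult[OF act_hom]
  by (auto intro!: module_homI simp: T.smult_r_distr A.m_comm simp flip: T.smult_assoc1)

text \<open>
  The action is linear in the tensor, so the bimodule condition is preserved by linear combinations.
\<close>

lemma coproduct_space_vectorspace: "vectorspace K (coproduct_space K A)"
proof (rule vs_criteria)
  let ?V = "coproduct_space K A"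
  show "\<forall>v\<in>carrier ?V. \<exists>w\<in>carrier ?V. v \<oplus>\<^bsub>?V\<^esub> w = \<zero>\<^bsub>?V\<^esub>"
  proof
    fix v assume v: "v \<in> carrier ?V"
    then have v': "v \<in> coproducts" by (simp add: coproduct_space_def)
    let ?w = "\<lambda>x\<in>carrier A. (\<ominus>\<^bsub>K\<^esub> \<one>\<^bsub>K\<^esub>) \<odot>\<^bsub>AA.T\<^esub> v x"
    have "?w \<in> carrier ?V"
      using smult_coproduct[OF v', of "\<ominus>\<^bsub>K\<^esub> \<one>\<^bsub>K\<^esub>"] by (simp add: coproduct_space_def)
    moreover have "v \<oplus>\<^bsub>?V\<^esub> ?w = \<zero>\<^bsub>?V\<^esub>"
      using coproductsD(4)[OF v']
      by (auto simp: coproduct_space_def T.smult_l_minus T.M.r_neg intro!: restrict_ext)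
    ultimately show "\<exists>w\<in>carrier ?V. v \<oplus>\<^bsub>?V\<^esub> w = \<zero>\<^bsub>?V\<^esub>" by blast
  qed
qed (auto simp: A.field_axioms coproduct_space_def zero_coproduct add_coproduct smult_coproduct
    coproductsD(2,4) T.M.a_ac T.smult_assoc1 T.smult_l_distr T.smult_r_distr
    intro!: restrict_ext extensionalityI[of _ "carrier A"])

text \<open>
  Write \<open>a = a 1 1 = 1 1 a\<close>.
\<close>

lemma coproduct_at_one:
  assumes D: "D \<in> coproducts" and a: "a \<in> carrier A"
  shows "D a = act a (D \<one>) \<one>" "act a (D \<one>) \<one> = act \<one> (D \<one>) a"
  using coproductsD(3)[OF D a, of \<one> \<one>] coproductsD(3)[OF D, of \<one> \<one> a] a by simp_all

text \<open>
  Evaluation at \<open>1\<close> embeds the coproducts into the central tensors, so a linear map that is injective on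
  the central tensors bounds their dimension.
\<close>

lemma Frobdim_le:
  assumes W: "vectorspace K W" and fd: "vectorspace.fin_dim K W" and f: "f \<in> module_hom K AA.T W"
    and ker: "\<And>t. \<lbrakk>t \<in> carrier AA.T; \<And>a. a \<in> carrier A \<Longrightarrow> act a t \<one> = act \<one> t a; f t = \<zero>\<^bsub>W\<^esub>\<rbrakk>
      \<Longrightarrow> t = \<zero>\<^bsub>AA.T\<^esub>"
  shows "Frobdim K A \<le> vectorspace.dim K W"
proof -
  let ?V = "coproduct_space K A" and ?U = "\<lambda>D. f (D \<one>)"
  have carr: "carrier ?V = coproducts" by (simp add: coproduct_space_def)
  have U: "?U \<in> module_hom K ?V W"
    by (rule module_homI)
      (auto simp: carr coproductsD(4) module_hom_mem[OF f] coproduct_space_def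
        module_hom_add[OF f] module_hom_smult[OF f])
  have "inj_on ?U (carrier ?V)"
  proof (rule linear_inj_onI[OF coproduct_space_vectorspace W U])
    fix D assume "D \<in> carrier ?V" and z: "f (D \<one>) = \<zero>\<^bsub>W\<^esub>"
    then have D: "D \<in> coproducts" by (simp add: carr)
    have 0: "D \<one> = \<zero>\<^bsub>AA.T\<^esub>"
      by (rule ker[OF coproductsD(4)[OF D one_closed] coproduct_at_one(2)[OF D] z])
    have "D a = \<zero>\<^bsub>AA.T\<^esub>" if a: "a \<in> carrier A" for a
    proof -
      interpret linear_map K AA.T AA.T "\<lambda>t. act a t \<one>"
        by (rule linear_mapI[OF T.vectorspace_axioms T.vectorspace_axioms act_hom[OF a one_closed]])
      show ?thesis using coproduct_at_one(1)[OF D a] 0 f0_is_0 by simp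
    qed
    then show "D = \<zero>\<^bsub>?V\<^esub>"
      using coproductsD(2)[OF D]
      by (auto simp: coproduct_space_def intro!: extensionalityI[of _ "carrier A"])
  qed
  then show ?thesis
    unfolding Frobdim_def by (rule linear_inj_dim_le(2)[OF coproduct_space_vectorspace W U _ fd])
qed

end


section \<open>Coordinates on the tensor square\<close>

text \<open>
  An algebra with a finite basis \<open>cl b\<close> for \<open>b \<in> B\<close>, presented by its coordinate map \<open>C\<close>.  Indexing the basis by
  \<open>B\<close>, instead of taking a subset of the algebra, allows paths to serve as indices.
\<close>

locale based_algebra = algebra_over K A for K and A (structure) +
  fixes B :: "'i set" and cl :: "'i \<Rightarrow> _" and C
  assumes finite_basis: "finite B"
    and cl_closed [simp]: "b \<in> B \<Longrightarrow> cl b \<in> carrier A"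
    and C_hom: "C \<in> module_hom K A (free_module K B)"
    and C_cl: "b \<in> B \<Longrightarrow> C (cl b) = basis_elem K b"
    and expand: "x \<in> carrier A \<Longrightarrow> free_ext K A cl (C x) = x"
begin

abbreviation "FB \<equiv> free_module K B"
abbreviation "FBB \<equiv> free_module K (B \<times> B)"

lemma C_closed [simp]: "x \<in> carrier A \<Longrightarrow> C x \<in> carrier FB"
  using module_hom_mem[OF C_hom] .

lemma C_app_closed [simp]: "x \<in> carrier A \<Longrightarrow> C x b \<in> carrier K"
  using A.free_carrier_app[OF C_closed] .

lemma hom_eq_on_basis:
  assumes W: "vectorspace K W" and f: "f \<in> module_hom K A W" and g: "g \<in> module_hom K A W"
    and eq: "\<And>b. b \<in> B \<Longrightarrow> f (cl b) = g (cl b)" and x: "x \<in> carrier A"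
  shows "f x = g x"
proof -
  have e: "free_ext K A cl \<in> module_hom K FB A" by (rule A.free_ext_hom) (auto intro: A.vectorspace_axioms)
  have "f (free_ext K A cl (C x)) = g (free_ext K A cl (C x))"
    by (rule A.free_hom_eqI[OF W module_hom_comp[OF e f] module_hom_comp[OF e g]])
      (use eq x in \<open>auto simp: A.free_ext_basis_elem[OF A.vectorspace_axioms]\<close>)
  then show ?thesis using x by (simp add: expand)
qed

text \<open>
  The coordinates of \<open>x \<otimes> y\<close> with respect to the products of basis elements.
\<close>

definition "prod_coord = (\<lambda>p q. C (fst p) (fst q) \<otimes>\<^bsub>K\<^esub> C (snd p) (snd q))"

lemma FBB_vectorspace: "vectorspace K FBB"
  by (rule A.free_vectorspace)

lemma prod_coord_closed:
  assumes "x \<in> carrier A" "y \<in> carrier A"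
  shows "prod_coord (x, y) \<in> carrier FBB"
proof -
  have "a \<in> B \<and> b \<in> B" if "C x a \<otimes>\<^bsub>K\<^esub> C y b \<noteq> \<zero>\<^bsub>K\<^esub>" for a b
    using that A.free_outside[OF C_closed] assms by (metis A.l_null A.r_null C_app_closed)
  then show ?thesis
    unfolding prod_coord_def
    by (intro A.free_carrierI[of _ _ "B \<times> B"]) (use assms finite_basis in auto)
qed

lemma C_add: "x \<in> carrier A \<Longrightarrow> y \<in> carrier A \<Longrightarrow> C (x \<oplus> y) b = C x b \<oplus>\<^bsub>K\<^esub> C y b"
  using module_hom_add[OF C_hom] by simp

lemma C_smult: "c \<in> carrier K \<Longrightarrow> x \<in> carrier A \<Longrightarrow> C (c \<odot> x) b = c \<otimes>\<^bsub>K\<^esub> C x b"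
  using module_hom_smult[OF C_hom] by simp

lemma prod_coord_bilinear: "bilinear_on K A A FBB prod_coord"
  unfolding bilinear_on_def
  by (auto intro!: module_homI simp: prod_coord_closed)
    (auto simp: prod_coord_def fun_eq_iff C_add C_smult A.l_distr A.r_distr A.m_ac)

definition "tensor_coord = tensor_lift K FBB prod_coord"

lemma tensor_coord_hom: "tensor_coord \<in> module_hom K AA.T FBB"
  unfolding tensor_coord_def by (rule AA.lift_hom[OF FBB_vectorspace prod_coord_bilinear])

text \<open>
  A tensor is recovered from its coordinates by the map that sends \<open>(b, c)\<close> to \<open>cl b \<otimes> cl c\<close>: by bilinearity
  it is enough to compare the two on products of basis elements.
\<close>

lemma tensor_coord_inj:
  assumes t: "t \<in> carrier AA.T" and z: "tensor_coord t = \<zero>\<^bsub>FBB\<^esub>"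
  shows "t = \<zero>\<^bsub>AA.T\<^esub>"
proof -
  let ?h = "\<lambda>q. AA.pure (cl (fst q)) (cl (snd q))" let ?back = "free_ext K AA.T ?h"
  note pb = bilinear_onD[OF AA.pure_bilinear, unfolded fst_conv snd_conv]
  have back_hom: "?back \<in> module_hom K FBB AA.T"
    by (rule A.free_ext_hom[OF T.vectorspace_axioms]) (auto intro: module_hom_mem[OF pb(1)])
  note bb = bilinear_onD[OF bilinear_on_hom[OF prod_coord_bilinear back_hom]]
  have base: "?back (prod_coord (cl b, cl c)) = AA.pure (cl b) (cl c)" if bc: "b \<in> B" "c \<in> B" for b c
  proof -
    have "prod_coord (cl b, cl c) = basis_elem K (b, c)"
      using bc by (auto simp: prod_coord_def C_cl basis_elem_def fun_eq_iff)
    then show ?thesis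
      using bc by (simp add: A.free_ext_basis_elem[OF T.vectorspace_axioms] module_hom_mem[OF pb(1)])
  qed
  have right: "?back (prod_coord (cl b, y)) = AA.pure (cl b) y" if "b \<in> B" "y \<in> carrier A" for b y
    by (rule hom_eq_on_basis[OF T.vectorspace_axioms bb(2) pb(2)]) (use that base in auto)
  have all: "?back (prod_coord (x, y)) = AA.pure x y" if "x \<in> carrier A" "y \<in> carrier A" for x y
    by (rule hom_eq_on_basis[OF T.vectorspace_axioms bb(1) pb(1)]) (use that right in auto)
  have id: "(\<lambda>t. t) \<in> module_hom K AA.T AA.T" by (auto simp: module_hom_def)
  have "?back (tensor_coord t) = t"
    by (rule AA.tensor_hom_eqI[OF T.vectorspace_axioms module_hom_comp[OF tensor_coord_hom back_hom] id _ t])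
      (simp add: tensor_coord_def AA.lift_pure[OF FBB_vectorspace prod_coord_bilinear] all)
  moreover have "?back \<zero>\<^bsub>FBB\<^esub> = \<zero>\<^bsub>AA.T\<^esub>"
  proof -
    interpret linear_map K FBB AA.T ?back
      by (rule linear_mapI[OF FBB_vectorspace T.vectorspace_axioms back_hom])
    show ?thesis by (rule f0_is_0)
  qed
  ultimately show ?thesis using z by simp
qed

lemma tensor_coord_act:
  assumes a: "a \<in> carrier A" and d: "d \<in> carrier A" and t: "t \<in> carrier AA.T" and f: "f \<in> t"
  shows "tensor_coord (act a t d) q =
    (\<Oplus>\<^bsub>K\<^esub> p \<in> {p. f p \<noteq> \<zero>\<^bsub>K\<^esub>}.
      f p \<otimes>\<^bsub>K\<^esub> (C (a \<otimes> fst p) (fst q) \<otimes>\<^bsub>K\<^esub> C (snd p \<otimes> d) (snd q)))"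
proof -
  let ?h = "\<lambda>p. prod_coord (a \<otimes> fst p, snd p \<otimes> d)"
  have bil: "bilinear_on K A A FBB ?h"
    using bilinear_on_comp[OF prod_coord_bilinear mult_left_hom[OF a] mult_right_hom[OF d]] .
  have "tensor_coord (act a t d) = tensor_lift K FBB ?h t"
    by (rule AA.tensor_hom_eqI[OF FBB_vectorspace module_hom_comp[OF act_hom[OF a d] tensor_coord_hom]
          AA.lift_hom[OF FBB_vectorspace bil] _ t])
      (use a d in \<open>simp add: act_pure AA.lift_pure[OF FBB_vectorspace bil] tensor_coord_def
          AA.lift_pure[OF FBB_vectorspace prod_coord_bilinear]\<close>)
  also have "\<dots> = free_ext K FBB ?h f"
    by (rule AA.lift_mem[OF FBB_vectorspace bil t f])
  finally have 1: "tensor_coord (act a t d) q = free_ext K FBB ?h f q" by simp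
  have fF: "f \<in> carrier AA.F" using AA.Q.quot_mem(1)[OF _ f] t by (simp add: AA.tensor_eq)
  have h: "?h p \<in> carrier FBB" "f p \<in> carrier K" if "f p \<noteq> \<zero>\<^bsub>K\<^esub>" for p
  proof -
    have "p \<in> carrier A \<times> carrier A" using A.free_support(2)[OF fF] that by blast
    then show "?h p \<in> carrier FBB" using a d by (auto intro: prod_coord_closed)
    show "f p \<in> carrier K" using fF by (rule A.free_carrier_app)
  qed
  interpret FBB: vectorspace K FBB by (rule FBB_vectorspace)
  show ?thesis unfolding 1 free_ext_def
    by (subst A.free_finsum_apply)
      (use A.free_support(1)[OF fF] h in \<open>auto simp: prod_coord_def simp del: free_module_simps intro: FBB.smult_closed\<close>,
       simp add: prod_coord_def)
qed

lemma tensor_coord_apply: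
  assumes t: "t \<in> carrier AA.T" and f: "f \<in> t"
  shows "tensor_coord t q =
    (\<Oplus>\<^bsub>K\<^esub> p \<in> {p. f p \<noteq> \<zero>\<^bsub>K\<^esub>}.
      f p \<otimes>\<^bsub>K\<^esub> (C (fst p) (fst q) \<otimes>\<^bsub>K\<^esub> C (snd p) (snd q)))"
proof -
  have id: "(\<lambda>t. t) \<in> module_hom K AA.T AA.T" by (auto simp: module_hom_def)
  have "act \<one> t \<one> = t"
    by (rule AA.tensor_hom_eqI[OF T.vectorspace_axioms act_hom id _ t]) (simp_all add: act_pure)
  moreover have fF: "f \<in> carrier AA.F" using AA.Q.quot_mem(1)[OF _ f] t by (simp add: AA.tensor_eq)
  ultimately have "tensor_coord t q = (\<Oplus>\<^bsub>K\<^esub> p \<in> {p. f p \<noteq> \<zero>\<^bsub>K\<^esub>}.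
      f p \<otimes>\<^bsub>K\<^esub> (C (\<one> \<otimes> fst p) (fst q) \<otimes>\<^bsub>K\<^esub> C (snd p \<otimes> \<one>) (snd q)))"
    using tensor_coord_act[OF one_closed one_closed t f, of q] by simp
  also have "\<dots> = (\<Oplus>\<^bsub>K\<^esub> p \<in> {p. f p \<noteq> \<zero>\<^bsub>K\<^esub>}.
      f p \<otimes>\<^bsub>K\<^esub> (C (fst p) (fst q) \<otimes>\<^bsub>K\<^esub> C (snd p) (snd q)))"
    by (rule A.R.finsum_cong') (use A.free_support(2)[OF fF] A.free_carrier_app[OF fF] in auto)
  finally show ?thesis .
qed

text \<open>
  To compare coefficients of \<open>a t d\<close> and of \<open>t\<close>, it suffices to do so for a decomposable tensor, that is, to
  know how multiplication by \<open>a\<close> and by \<open>d\<close> acts on coordinates in \<open>A\<close>.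
\<close>

lemma tensor_coord_act_eq:
  assumes a: "a \<in> carrier A" and d: "d \<in> carrier A" and t: "t \<in> carrier AA.T"
    and eq: "\<And>x y. x \<in> carrier A \<Longrightarrow> y \<in> carrier A \<Longrightarrow>
      C (a \<otimes> x) b \<otimes>\<^bsub>K\<^esub> C (y \<otimes> d) c = C x b' \<otimes>\<^bsub>K\<^esub> C y c'"
  shows "tensor_coord (act a t d) (b, c) = tensor_coord t (b', c')"
proof -
  obtain f where f: "f \<in> t"
    using t AA.Q.proj_self by (auto elim!: AA.Q.quot_carrierE simp: AA.tensor_eq)
  have fF: "f \<in> carrier AA.F" using AA.Q.quot_mem(1)[OF _ f] t by (simp add: AA.tensor_eq)
  show ?thesis
    unfolding tensor_coord_act[OF a d t f] tensor_coord_apply[OF t f] fst_conv snd_conv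
    by (rule A.R.finsum_cong') (use A.free_support(2)[OF fF] eq A.free_carrier_app[OF fF] in auto)
qed

lemma tensor_coord_act_zero:
  assumes a: "a \<in> carrier A" and d: "d \<in> carrier A" and t: "t \<in> carrier AA.T"
    and eq: "\<And>x y. x \<in> carrier A \<Longrightarrow> y \<in> carrier A \<Longrightarrow>
      C (a \<otimes> x) b \<otimes>\<^bsub>K\<^esub> C (y \<otimes> d) c = \<zero>\<^bsub>K\<^esub>"
  shows "tensor_coord (act a t d) (b, c) = \<zero>\<^bsub>K\<^esub>"
proof -
  obtain f where f: "f \<in> t"
    using t AA.Q.proj_self by (auto elim!: AA.Q.quot_carrierE simp: AA.tensor_eq)
  have fF: "f \<in> carrier AA.F" using AA.Q.quot_mem(1)[OF _ f] t by (simp add: AA.tensor_eq)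
  show ?thesis
    unfolding tensor_coord_act[OF a d t f] fst_conv snd_conv
    by (rule A.R.add.finprod_one_eqI) (use A.free_support(2)[OF fF] eq A.free_carrier_app[OF fF] in auto)
qed

end


section \<open>The algebra of a quiver with an admissible ideal\<close>

lemma path_algebra_simps [simp]:
  "carrier (path_algebra K Q) = carrier (free_module K (quiver_paths Q))"
  "\<zero>\<^bsub>path_algebra K Q\<^esub> = (\<lambda>b. \<zero>\<^bsub>K\<^esub>)"
  "f \<oplus>\<^bsub>path_algebra K Q\<^esub> g = (\<lambda>b. f b \<oplus>\<^bsub>K\<^esub> g b)"
  "c \<odot>\<^bsub>path_algebra K Q\<^esub> f = (\<lambda>b. c \<otimes>\<^bsub>K\<^esub> f b)"
  by (simp_all add: path_algebra_def free_module_def)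

lemma path_mult_apply:
  "(f \<otimes>\<^bsub>path_algebra K Q\<^esub> g) (u, es) = (\<Oplus>\<^bsub>K\<^esub> i \<in> {..length es}.
    f (u, take i es) \<otimes>\<^bsub>K\<^esub> g (pre_digraph.awlast Q u (take i es), drop i es))"
  by (simp add: path_algebra_def)

locale admissible_quotient = F: field K + Qv: fin_digraph Q
  for K :: "('k, 'r) ring_scheme" and Q :: "('v, 'e) pre_digraph" +
  fixes I
  assumes admissible: "admissible_ideal K Q I"
begin

abbreviation "kQ \<equiv> path_algebra K Q"
abbreviation "A \<equiv> bound_quiver_algebra K Q I"
abbreviation "paths \<equiv> quiver_paths Q"
abbreviation "cls \<equiv> path_class K Q I"
abbreviation "d \<equiv> basis_elem K"

definition "short = (\<lambda>v. (v, [])) ` verts Q \<union> (\<lambda>e. (tail Q e, [e])) ` arcs Q"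

sublocale I: ideal I kQ
  using admissible by (simp add: admissible_ideal_def)

sublocale kQ: vectorspace K kQ
  by (rule vectorspace_cong[OF F.free_vectorspace[of paths]]) auto

lemma short_paths: "short \<subseteq> paths"
proof -
  have "(v, []) \<in> paths" if "v \<in> verts Q" for v
    using that by (auto simp: quiver_paths_def Qv.awalk_def)
  moreover have "(tail Q e, [e]) \<in> paths" if "e \<in> arcs Q" for e
    using Qv.arc_implies_awalk[OF that] by (auto simp: quiver_paths_def)
  ultimately show ?thesis by (auto simp: short_def)
qed

lemma path_mult_trivial:
  assumes "f \<in> carrier kQ" "g \<in> carrier kQ"
  shows "(f \<otimes>\<^bsub>kQ\<^esub> g) (u, []) = f (u, []) \<otimes>\<^bsub>K\<^esub> g (u, [])"
  using assms by (simp add: path_mult_apply)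

text \<open>
  An arrow can only be cut at its two ends.
\<close>

lemma path_mult_arrow:
  assumes "f \<in> carrier kQ" "g \<in> carrier kQ"
  shows "(f \<otimes>\<^bsub>kQ\<^esub> g) (u, [e]) =
    f (u, []) \<otimes>\<^bsub>K\<^esub> g (u, [e]) \<oplus>\<^bsub>K\<^esub> f (u, [e]) \<otimes>\<^bsub>K\<^esub> g (head Q e, [])"
proof -
  have "{..length [e]} = {0, 1}" by auto
  then show ?thesis
    using assms by (simp add: path_mult_apply F.a_comm)
qed

lemma smult_mult:
  assumes c: "c \<in> carrier K" and f: "f \<in> carrier kQ" and g: "g \<in> carrier kQ"
  shows "(c \<odot>\<^bsub>kQ\<^esub> f) \<otimes>\<^bsub>kQ\<^esub> g = c \<odot>\<^bsub>kQ\<^esub> (f \<otimes>\<^bsub>kQ\<^esub> g)"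
    and "f \<otimes>\<^bsub>kQ\<^esub> (c \<odot>\<^bsub>kQ\<^esub> g) = c \<odot>\<^bsub>kQ\<^esub> (f \<otimes>\<^bsub>kQ\<^esub> g)"
  using assms
  by (auto simp: fun_eq_iff path_mult_apply F.finsum_rdistr F.m_assoc F.m_lcomm intro!: F.finsum_cong')

text \<open>
  An ideal is closed under scalars because \<open>c f = (c 1) f\<close>.
\<close>

lemma I_submodule: "submodule K I kQ"
proof (rule submodule.intro)
  show "c \<odot>\<^bsub>kQ\<^esub> f \<in> I" if c: "c \<in> carrier K" and f: "f \<in> I" for c f
  proof -
    have fc: "f \<in> carrier kQ" using f I.a_subset by blast
    have "(c \<odot>\<^bsub>kQ\<^esub> \<one>\<^bsub>kQ\<^esub>) \<otimes>\<^bsub>kQ\<^esub> f = c \<odot>\<^bsub>kQ\<^esub> f"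
      using smult_mult(1)[OF c I.one_closed fc] I.l_one[OF fc] by simp
    moreover have "c \<odot>\<^bsub>kQ\<^esub> \<one>\<^bsub>kQ\<^esub> \<in> carrier kQ" using c I.one_closed by (rule kQ.smult_closed)
    ultimately show ?thesis using I.I_l_closed[OF f] by metis
  qed
  show "Module.module K kQ" by (rule kQ.module_axioms)
  show "\<zero>\<^bsub>kQ\<^esub> \<in> I" by (rule additive_subgroup.zero_closed[OF I.additive_subgroup_axioms])
  show "f \<oplus>\<^bsub>kQ\<^esub> g \<in> I" if "f \<in> I" "g \<in> I" for f g
    using that by (rule additive_subgroup.a_closed[OF I.additive_subgroup_axioms])
qed (rule I.a_subset)

sublocale V: vector_quotient K kQ I
  by (rule vector_quotient.intro[OF kQ.vectorspace_axioms vector_quotient_axioms.intro[OF I_submodule]])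

lemma A_eq: "A = V.Q"
  by (simp add: bound_quiver_algebra_def)

lemma cls_eq: "cls p = V.proj (d p)"
  by (simp add: path_class_def)

lemma proj_mult:
  assumes "f \<in> carrier kQ" "g \<in> carrier kQ"
  shows "V.proj f \<otimes>\<^bsub>A\<^esub> V.proj g = V.proj (f \<otimes>\<^bsub>kQ\<^esub> g)"
  using I.rcoset_mult_add[OF assms]
  by (simp add: bound_quiver_algebra_def quot_module_def FactRing_def)

lemma proj_one: "\<one>\<^bsub>A\<^esub> = V.proj \<one>\<^bsub>kQ\<^esub>"
  by (simp add: bound_quiver_algebra_def quot_module_def FactRing_def)

text \<open>
  All laws are inherited from the path algebra by choosing representatives.
\<close>

lemma A_algebra: "algebra_over K A"
proof -
  have mult: "f \<otimes>\<^bsub>kQ\<^esub> g \<in> carrier kQ" if "f \<in> carrier kQ" "g \<in> carrier kQ" for f g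
    using that by (rule I.m_closed)
  have sm: "c \<odot>\<^bsub>kQ\<^esub> f \<in> carrier kQ" if "c \<in> carrier K" "f \<in> carrier kQ" for c f
    using that by (rule kQ.smult_closed)
  have add: "f \<oplus>\<^bsub>kQ\<^esub> g \<in> carrier kQ" if "f \<in> carrier kQ" "g \<in> carrier kQ" for f g
    using that by (rule I.a_closed)
  show ?thesis
  proof (intro algebra_over.intro algebra_over_axioms.intro module_homI)
    show "vectorspace K A" using V.quot_vectorspace by (simp only: A_eq)
    show "\<one>\<^bsub>A\<^esub> \<in> carrier A" unfolding proj_one unfolding A_eq by (rule V.proj_closed[OF I.one_closed])
    fix x assume "x \<in> carrier A"
    then obtain f where f: "f \<in> carrier kQ" "x = V.proj f" unfolding A_eq by (rule V.quot_carrierE)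
    show "\<one>\<^bsub>A\<^esub> \<otimes>\<^bsub>A\<^esub> x = x" "x \<otimes>\<^bsub>A\<^esub> \<one>\<^bsub>A\<^esub> = x"
      unfolding f(2) proj_one using f(1) proj_mult[OF I.one_closed f(1)] proj_mult[OF f(1) I.one_closed]
      by (simp_all only: I.l_one I.r_one)
    fix y assume "y \<in> carrier A"
    then obtain g where g: "g \<in> carrier kQ" "y = V.proj g" unfolding A_eq by (rule V.quot_carrierE)
    \<comment> \<open>Closure is a goal twice, for multiplication from the left and from the right.\<close>
    show "x \<otimes>\<^bsub>A\<^esub> y \<in> carrier A" "x \<otimes>\<^bsub>A\<^esub> y \<in> carrier A"
      unfolding f(2) g(2) proj_mult[OF f(1) g(1)] unfolding A_eq
      by (rule V.proj_closed[OF mult[OF f(1) g(1)]])+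
    show "x \<otimes>\<^bsub>A\<^esub> (c \<odot>\<^bsub>A\<^esub> y) = c \<odot>\<^bsub>A\<^esub> (x \<otimes>\<^bsub>A\<^esub> y)"
      "(c \<odot>\<^bsub>A\<^esub> y) \<otimes>\<^bsub>A\<^esub> x = c \<odot>\<^bsub>A\<^esub> (y \<otimes>\<^bsub>A\<^esub> x)" if c: "c \<in> carrier K" for c
      unfolding f(2) g(2)
      using V.quot_smult[OF c g(1), folded A_eq] V.quot_smult[OF c mult[OF f(1) g(1)], folded A_eq]
        V.quot_smult[OF c mult[OF g(1) f(1)], folded A_eq]
        proj_mult[OF f(1) g(1)] proj_mult[OF g(1) f(1)]
        proj_mult[OF f(1) sm[OF c g(1)]] proj_mult[OF sm[OF c g(1)] f(1)]
        smult_mult[OF c f(1) g(1)] smult_mult[OF c g(1) f(1)]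
      by metis+
    fix z assume "z \<in> carrier A"
    then obtain h where h: "h \<in> carrier kQ" "z = V.proj h" unfolding A_eq by (rule V.quot_carrierE)
    show "x \<otimes>\<^bsub>A\<^esub> (y \<oplus>\<^bsub>A\<^esub> z) = x \<otimes>\<^bsub>A\<^esub> y \<oplus>\<^bsub>A\<^esub> x \<otimes>\<^bsub>A\<^esub> z"
      unfolding f(2) g(2) h(2)
      using V.quot_add[OF g(1) h(1), folded A_eq] proj_mult[OF f(1) add[OF g(1) h(1)]]
        proj_mult[OF f(1) g(1)] proj_mult[OF f(1) h(1)] I.r_distr[OF g(1) h(1) f(1)]
        V.quot_add[OF mult[OF f(1) g(1)] mult[OF f(1) h(1)], folded A_eq]
      by metis
    show "(y \<oplus>\<^bsub>A\<^esub> z) \<otimes>\<^bsub>A\<^esub> x = y \<otimes>\<^bsub>A\<^esub> x \<oplus>\<^bsub>A\<^esub> z \<otimes>\<^bsub>A\<^esub> x"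
      unfolding f(2) g(2) h(2)
      using V.quot_add[OF g(1) h(1), folded A_eq] proj_mult[OF add[OF g(1) h(1)] f(1)]
        proj_mult[OF g(1) f(1)] proj_mult[OF h(1) f(1)] I.l_distr[OF g(1) h(1) f(1)]
        V.quot_add[OF mult[OF g(1) f(1)] mult[OF h(1) f(1)], folded A_eq]
      by metis
  qed
qed

text \<open>
  The elements without trivial paths form an ideal that contains the arrows.
\<close>

lemma arrow_ideal_trivial:
  assumes "f \<in> arrow_ideal K Q"
  shows "f (u, []) = \<zero>\<^bsub>K\<^esub>" "f \<in> carrier kQ"
proof -
  let ?J = "{f \<in> carrier kQ. \<forall>u. f (u, []) = \<zero>\<^bsub>K\<^esub>}"
  have J: "ideal ?J kQ"
  proof (rule idealI)
    show "subgroup ?J (add_monoid kQ)"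
    proof (rule I.add.subgroupI)
      show "\<ominus>\<^bsub>kQ\<^esub> f \<in> ?J" if "f \<in> ?J" for f
      proof -
        have f: "f \<in> carrier kQ" "\<forall>u. f (u, []) = \<zero>\<^bsub>K\<^esub>" using that by auto
        have "\<ominus>\<^bsub>kQ\<^esub> f = (\<ominus>\<^bsub>K\<^esub> \<one>\<^bsub>K\<^esub>) \<odot>\<^bsub>kQ\<^esub> f"
          using kQ.smult_l_minus[of "\<one>\<^bsub>K\<^esub>" f] f(1) kQ.smult_one by simp
        then show ?thesis using f I.a_inv_closed[OF f(1)] by simp
      qed
      have "\<zero>\<^bsub>kQ\<^esub> \<in> ?J" by (simp add: free_module_carrier)
      then show "?J \<noteq> {}" by blast
    qed (auto simp: F.free_add_closed)
  qed (use I.m_closed in \<open>auto simp: path_mult_trivial I.ring_axioms\<close>)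
  have "d (tail Q e, [e]) \<in> ?J" if "e \<in> arcs Q" for e
  proof -
    have "d (tail Q e, [e]) \<in> carrier kQ"
      using that short_paths by (auto simp: short_def intro!: F.basis_elem_carrier)
    moreover have "d (tail Q e, [e]) (u, []) = \<zero>\<^bsub>K\<^esub>" for u
      by (simp add: basis_elem_def)
    ultimately show ?thesis by blast
  qed
  then have "arrow_ideal K Q \<subseteq> ?J"
    unfolding arrow_ideal_def by (intro I.genideal_minimal[OF J]) blast
  then show "f (u, []) = \<zero>\<^bsub>K\<^esub>" "f \<in> carrier kQ" using assms by auto
qed

text \<open>
  In a product of two elements without trivial paths every path has length at least two.  So the square
  of the arrow ideal, which contains \<open>I\<close>, vanishes on the short paths.
\<close>

lemma I_short_zero:
  assumes f: "f \<in> I" and p: "p \<in> short"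
  shows "f p = \<zero>\<^bsub>K\<^esub>"
proof -
  let ?R = "arrow_ideal K Q"
  have arrows: "(\<lambda>e. d (tail Q e, [e])) ` arcs Q \<subseteq> carrier kQ"
    using short_paths by (auto simp: short_def intro!: F.basis_elem_carrier)
  have R: "ideal ?R kQ" unfolding arrow_ideal_def by (rule I.genideal_ideal[OF arrows])
  have "f \<in> ?R [^]\<^bsub>ideals_set kQ\<^esub> (2::nat)" using admissible f by (auto simp: admissible_ideal_def)
  then have f': "f \<in> ideal_prod kQ (ideal_prod kQ (carrier kQ) ?R) ?R"
    by (simp add: ideals_set_def nat_pow_def numeral_2_eq_2)
  have sub: "ideal_prod kQ (carrier kQ) ?R \<subseteq> ?R"
    using I.ideal_prod_inter[OF I.oneideal R] by blast
  from f' have "f \<in> carrier kQ \<and> (\<forall>u. f (u, []) = \<zero>\<^bsub>K\<^esub>) \<and> (\<forall>u e. f (u, [e]) = \<zero>\<^bsub>K\<^esub>)"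
  proof (induction rule: ideal_prod.induct)
    case (prod g h)
    have g: "g \<in> ?R" using prod sub by blast
    note z = arrow_ideal_trivial[OF g] arrow_ideal_trivial[OF prod(2)]
    show ?case using z I.m_closed[OF z(2) z(4)] F.free_carrier_app
      by (simp add: path_mult_trivial path_mult_arrow)
  next
    case (sum g h)
    then show ?case by (simp add: F.free_add_closed)
  qed
  then show ?thesis using p by (auto simp: short_def)
qed

end


section \<open>Bases consisting of paths\<close>

context admissible_quotient
begin

lemma A_vectorspace: "vectorspace K A"
  using V.quot_vectorspace by (simp only: A_eq)

lemma proj_hom: "V.proj \<in> module_hom K kQ A"
  using V.proj_hom by (simp only: A_eq)

lemma sub_free_carrier: "B \<subseteq> paths \<Longrightarrow> g \<in> carrier (F.free B) \<Longrightarrow> g \<in> carrier kQ"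
  using F.free_mono by simp

lemma proj_free_hom:
  assumes B: "B \<subseteq> paths"
  shows "V.proj \<in> module_hom K (F.free B) A"
proof (rule module_homI)
  fix g assume "g \<in> carrier (F.free B)"
  then have g: "g \<in> carrier kQ" by (rule sub_free_carrier[OF B])
  show "V.proj g \<in> carrier A" by (rule module_hom_mem[OF proj_hom g])
  show "V.proj (c \<odot>\<^bsub>F.free B\<^esub> g) = c \<odot>\<^bsub>A\<^esub> V.proj g" if "c \<in> carrier K" for c
    using module_hom_smult[OF proj_hom that g] by simp
  fix h assume "h \<in> carrier (F.free B)"
  then have h: "h \<in> carrier kQ" by (rule sub_free_carrier[OF B])
  show "V.proj (g \<oplus>\<^bsub>F.free B\<^esub> h) = V.proj g \<oplus>\<^bsub>A\<^esub> V.proj h"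
    using module_hom_add[OF proj_hom g h] by simp
qed

lemma proj_zero_iff: "f \<in> carrier kQ \<Longrightarrow> V.proj f = \<zero>\<^bsub>A\<^esub> \<longleftrightarrow> f \<in> I"
  unfolding A_eq using V.quot_zero V.proj_eq_iff[of f "\<zero>\<^bsub>kQ\<^esub>"] I.minus_eq I.minus_zero I.r_zero
  by (metis I.zero_closed)

lemma independent_inj:
  assumes B: "B \<subseteq> paths" and ind: "\<And>g. g \<in> I \<Longrightarrow> g \<in> carrier (F.free B) \<Longrightarrow> g = (\<lambda>_. \<zero>\<^bsub>K\<^esub>)"
  shows "inj_on V.proj (carrier (F.free B))"
  by (rule linear_inj_onI[OF F.free_vectorspace A_vectorspace proj_free_hom[OF B]])
    (use ind sub_free_carrier[OF B] proj_zero_iff in auto)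

lemma cls_closed: "p \<in> paths \<Longrightarrow> cls p \<in> carrier A"
  by (auto simp: cls_eq intro!: module_hom_mem[OF proj_hom] F.basis_elem_carrier)

lemma cls_span:
  assumes S: "S \<subseteq> paths" and fd: "vectorspace.fin_dim K A"
  defines "W \<equiv> A\<lparr>carrier := module.span K A (cls ` S)\<rparr>"
  shows "vectorspace K W" "vectorspace.fin_dim K W" "vectorspace.dim K W \<le> vectorspace.dim K A"
proof -
  interpret A: vectorspace K A by (rule A_vectorspace)
  have cS: "cls ` S \<subseteq> carrier A" using S cls_closed by blast
  show W: "vectorspace K W"
    unfolding W_def by (rule A.subspace_is_vs[OF A.span_is_subspace[OF cS]])
  have "(\<lambda>x. x) \<in> module_hom K W A" "inj_on (\<lambda>x. x) (carrier W)"
    using A.span_is_subset2[OF cS] by (auto simp: W_def module_hom_def inj_on_def)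
  then show "vectorspace.fin_dim K W" "vectorspace.dim K W \<le> vectorspace.dim K A"
    using linear_inj_dim_le[OF W A_vectorspace] fd by blast+
qed

text \<open>
  The condition on \<open>B\<close> says that the classes of its members are pairwise distinct and linearly independent;
  it makes the projection injective on the combinations of \<open>B\<close>.  Taking for \<open>S\<close> all paths bounds the size
  of \<open>B\<close> by the dimension of \<open>A\<close>; taking the paths that start or end at a vertex gives the bounds for the
  numbers in the claim.
\<close>

lemma independent_card_le:
  assumes B: "B \<subseteq> paths" "finite B"
    and ind: "\<And>g. g \<in> I \<Longrightarrow> g \<in> carrier (F.free B) \<Longrightarrow> g = (\<lambda>_. \<zero>\<^bsub>K\<^esub>)"
    and S: "B \<subseteq> S" "S \<subseteq> paths" and fd: "vectorspace.fin_dim K A"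
  shows "card B \<le> span_dim K A (cls ` S)"
proof -
  interpret A: vectorspace K A by (rule A_vectorspace)
  have cS: "cls ` S \<subseteq> carrier A" using S(2) cls_closed by blast
  let ?W = "A.span (cls ` S)"
  interpret W: submodule K ?W A by (rule A.span_is_submodule[OF cS])
  note ph = proj_free_hom[OF B(1)]
  interpret FB: vectorspace K "F.free B" by (rule F.free_vectorspace)
  have "submodule K {g \<in> carrier (F.free B). V.proj g \<in> ?W} (F.free B)"
  proof (rule submodule.intro)
    have "V.proj \<zero>\<^bsub>kQ\<^esub> = \<zero>\<^bsub>A\<^esub>" unfolding A_eq by (rule V.quot_zero[symmetric])
    then show "\<zero>\<^bsub>F.free B\<^esub> \<in> {g \<in> carrier (F.free B). V.proj g \<in> ?W}"
      using W.zero_closed F.free_zero_closed by simp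
  qed (auto simp: module_hom_add[OF ph] module_hom_smult[OF ph] FB.module_axioms
      W.m_closed W.smult_closed simp del: free_module_simps)
  from F.free_generated[OF this] have inW: "V.proj g \<in> ?W" if "g \<in> carrier (F.free B)" for g
    using that A.in_own_span[OF cS] S by (auto simp: cls_eq)
  have hom: "V.proj \<in> module_hom K (F.free B) (A.vs ?W)"
    using ph inW by (auto simp: module_hom_def)
  note W = cls_span[OF S(2) fd]
  show ?thesis
    using linear_inj_dim_le(2)[OF F.free_vectorspace W(1) hom independent_inj[OF B(1) ind] W(2)]
    unfolding F.free_dim(2)[OF B(2)] span_dim_def by simp
qed

text \<open>
  A basis of \<open>A\<close> made of paths, expressed inside the path algebra, which is the direct sum of \<open>I\<close> and the
  combinations of \<open>B\<close>.
\<close>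

definition "path_basis B \<longleftrightarrow> B \<subseteq> paths \<and> finite B \<and> short \<subseteq> B \<and>
  (\<forall>g\<in>I. g \<in> carrier (F.free B) \<longrightarrow> g = (\<lambda>_. \<zero>\<^bsub>K\<^esub>)) \<and>
  (\<forall>f\<in>carrier kQ. \<exists>g\<in>carrier (F.free B). V.proj f = V.proj g)"

text \<open>
  Take \<open>B\<close> maximal among the finite sets of paths that contain the short ones and are independent modulo
  \<open>I\<close>.  The short paths themselves form such a set, as the elements of \<open>I\<close> vanish on them, and the dimension
  of \<open>A\<close> bounds the sizes.  By maximality every path outside \<open>B\<close> occurs in an element of \<open>I\<close> all of whose
  other paths belong to \<open>B\<close>, which expresses its class by those of \<open>B\<close>.
\<close>

lemma path_basis_exists:
  assumes fd: "vectorspace.fin_dim K A"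
  shows "\<exists>B. path_basis B"
proof -
  let ?ind = "\<lambda>B. \<forall>g\<in>I. g \<in> carrier (F.free B) \<longrightarrow> g = (\<lambda>_. \<zero>\<^bsub>K\<^esub>)"
  let ?P = "\<lambda>B. B \<subseteq> paths \<and> finite B \<and> short \<subseteq> B \<and> ?ind B"
  have "?P short"
  proof (intro conjI ballI impI)
    show "finite short" by (simp add: short_def)
    fix g assume g: "g \<in> I" "g \<in> carrier (F.free short)"
    show "g = (\<lambda>_. \<zero>\<^bsub>K\<^esub>)"
    proof
      show "g p = \<zero>\<^bsub>K\<^esub>" for p
        using I_short_zero[OF g(1)] F.free_outside[OF g(2)] by (cases "p \<in> short") auto
    qed
  qed (use short_paths in auto)
  moreover have "finite B \<and> card B \<le> vectorspace.dim K A" if "?P B" for B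
    using independent_card_le[of B paths] cls_span(3)[OF subset_refl fd] that fd
    unfolding span_dim_def by (meson order_trans subset_refl)
  ultimately obtain B where "finite B" and max: "maximal B ?P"
    using maximal_exists[of ?P "vectorspace.dim K A" short] by blast
  then have P: "?P B" by (simp add: maximal_def)
  have gen: "\<exists>g\<in>carrier (F.free B). V.proj (d p) = V.proj g" if p: "p \<in> paths" for p
  proof (cases "p \<in> B")
    case False
    then have "\<not> ?P (insert p B)" using max unfolding maximal_def by blast
    then have "\<not> ?ind (insert p B)" using P p by blast
    then obtain h where h: "h \<in> I" "h \<in> carrier (F.free (insert p B))" "h \<noteq> (\<lambda>_. \<zero>\<^bsub>K\<^esub>)" by blast
    have hc: "h q \<in> carrier K" for q using h(2) by (rule F.free_carrier_app)
    have hp: "h p \<noteq> \<zero>\<^bsub>K\<^esub>"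
    proof
      assume "h p = \<zero>\<^bsub>K\<^esub>"
      then have "h \<in> carrier (F.free B)"
        using h(2) P by (auto simp: free_module_carrier)
      then show False using P h by blast
    qed
    define c where "c = inv\<^bsub>K\<^esub> (h p)"
    have c: "c \<in> carrier K" "c \<otimes>\<^bsub>K\<^esub> h p = \<one>\<^bsub>K\<^esub>"
      using hp hc[of p] F.field_Units unfolding c_def by auto
    \<comment> \<open>Solve \<open>h \<equiv> 0\<close> modulo \<open>I\<close> for the path \<open>p\<close>.\<close>
    define g where "g = (\<lambda>q. if q = p then \<zero>\<^bsub>K\<^esub> else \<ominus>\<^bsub>K\<^esub> (c \<otimes>\<^bsub>K\<^esub> h q))"
    have g: "g \<in> carrier (F.free B)"
    proof (rule F.free_carrierI[of _ _ B])
      show "q \<in> B" if "g q \<noteq> \<zero>\<^bsub>K\<^esub>" for q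
      proof (rule ccontr)
        assume "q \<notin> B"
        then have "g q = \<zero>\<^bsub>K\<^esub>" using c F.free_outside[OF h(2), of q] by (simp add: g_def)
        then show False using that by blast
      qed
    qed (use c hc P in \<open>auto simp: g_def\<close>)
    have gk: "g \<in> carrier kQ" and dk: "d p \<in> carrier kQ"
      using sub_free_carrier[OF _ g] P p by auto
    have ch: "c \<odot>\<^bsub>kQ\<^esub> h \<in> I" using V.N.smult_closed[OF c(1) h(1)] .
    have "d p = (c \<odot>\<^bsub>kQ\<^esub> h) \<oplus>\<^bsub>kQ\<^esub> g"
      using c hc by (auto simp: fun_eq_iff g_def basis_elem_def F.r_neg)
    then have "d p \<ominus>\<^bsub>kQ\<^esub> g = c \<odot>\<^bsub>kQ\<^esub> h"
      using gk dk ch I.a_subset I.add.inv_solve_right[of "c \<odot>\<^bsub>kQ\<^esub> h" "d p" g]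
      by (metis (no_types, lifting) a_minus_def in_mono)
    then have "V.proj (d p) = V.proj g" using V.proj_eq_iff[OF dk gk] ch by simp
    then show ?thesis using g by blast
  qed (auto intro: bexI[of _ "d p"])
  let ?H = "{f \<in> carrier kQ. \<exists>g\<in>carrier (F.free B). V.proj f = V.proj g}"
  interpret FB: vectorspace K "F.free B" by (rule F.free_vectorspace)
  interpret FP: vectorspace K "F.free paths" by (rule F.free_vectorspace)
  have B: "B \<subseteq> paths" using P by blast
  have "submodule K ?H (F.free paths)"
  proof (rule submodule.intro)
    fix f f' assume "f \<in> ?H" "f' \<in> ?H"
    then obtain g g' where g: "f \<in> carrier kQ" "f' \<in> carrier kQ" "g \<in> carrier (F.free B)" "g' \<in> carrier (F.free B)"
      "V.proj f = V.proj g" "V.proj f' = V.proj g'" by auto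
    have "V.proj (f \<oplus>\<^bsub>kQ\<^esub> f') = V.proj (g \<oplus>\<^bsub>F.free B\<^esub> g')"
      unfolding module_hom_add[OF proj_hom g(1,2)] module_hom_add[OF proj_free_hom[OF B] g(3,4)]
      using g(5,6) by simp
    then show "f \<oplus>\<^bsub>F.free paths\<^esub> f' \<in> ?H"
      using FB.M.a_closed[OF g(3,4)] I.a_closed[OF g(1,2)] by auto
  next
    fix c f assume c: "c \<in> carrier K" and "f \<in> ?H"
    then obtain g where g: "f \<in> carrier kQ" "g \<in> carrier (F.free B)" "V.proj f = V.proj g" by auto
    have "V.proj (c \<odot>\<^bsub>kQ\<^esub> f) = V.proj (c \<odot>\<^bsub>F.free B\<^esub> g)"
      unfolding module_hom_smult[OF proj_hom c g(1)] module_hom_smult[OF proj_free_hom[OF B] c g(2)]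
      using g(3) by simp
    then show "c \<odot>\<^bsub>F.free paths\<^esub> f \<in> ?H"
      using FB.smult_closed[OF c g(2)] kQ.smult_closed[OF c g(1)] by auto
  next
    have "\<zero>\<^bsub>F.free paths\<^esub> \<in> carrier kQ" "\<zero>\<^bsub>F.free paths\<^esub> \<in> carrier (F.free B)"
      by (auto simp: free_module_carrier)
    then show "\<zero>\<^bsub>F.free paths\<^esub> \<in> ?H" by blast
  qed (auto simp: FP.module_axioms)
  then have "f \<in> ?H" if "f \<in> carrier kQ" for f
    using F.free_generated[of ?H paths f] gen that by auto
  then show ?thesis unfolding path_basis_def using P by blast
qed

end


section \<open>Coordinates with respect to a basis of paths\<close>

locale based_quiver_algebra = admissible_quotient K Q I
  for K :: "('k, 'r) ring_scheme" and Q :: "('v, 'e) pre_digraph" and I +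
  fixes B
  assumes path_basis: "path_basis B"
begin

lemma B_paths: "B \<subseteq> paths" and B_finite: "finite B" and B_short: "short \<subseteq> B"
  using path_basis by (auto simp: path_basis_def)

lemma B_generates: "x \<in> carrier A \<Longrightarrow> \<exists>g\<in>carrier (F.free B). V.proj g = x"
  using path_basis unfolding path_basis_def A_eq by (metis V.quot_carrierE)

lemma B_inj: "inj_on V.proj (carrier (F.free B))"
  using path_basis by (intro independent_inj[OF B_paths]) (auto simp: path_basis_def)

text \<open>
  The coordinates of \<open>x\<close> are at the same time the distinguished representative of \<open>x\<close> in the path algebra,
  as functions supported on \<open>B\<close> are elements of the path algebra.
\<close>

definition "coord x = (THE g. g \<in> carrier (F.free B) \<and> V.proj g = x)"

lemma coord_proj [simp]:
  assumes "g \<in> carrier (F.free B)" shows "coord (V.proj g) = g"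
  unfolding coord_def using assms inj_onD[OF B_inj] by (intro the_equality) auto

lemma coord:
  assumes "x \<in> carrier A"
  shows coord_closed: "coord x \<in> carrier (F.free B)" and proj_coord: "V.proj (coord x) = x"
  using B_generates[OF assms] by auto

lemma coord_kQ: "x \<in> carrier A \<Longrightarrow> coord x \<in> carrier kQ"
  using coord_closed sub_free_carrier[OF B_paths] by blast

lemma coord_hom: "coord \<in> module_hom K A (F.free B)"
proof (rule module_homI)
  interpret FB: vectorspace K "F.free B" by (rule F.free_vectorspace)
  note ph = proj_free_hom[OF B_paths]
  fix x assume x: "x \<in> carrier A"
  show "coord x \<in> carrier (F.free B)" by (rule coord_closed[OF x])
  show "coord (c \<odot>\<^bsub>A\<^esub> x) = c \<odot>\<^bsub>F.free B\<^esub> coord x" if c: "c \<in> carrier K" for c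
    using coord_proj[OF FB.smult_closed[OF c coord_closed[OF x]]]
      module_hom_smult[OF ph c coord_closed[OF x]] proj_coord[OF x] by metis
  fix y assume y: "y \<in> carrier A"
  show "coord (x \<oplus>\<^bsub>A\<^esub> y) = coord x \<oplus>\<^bsub>F.free B\<^esub> coord y"
    using coord_proj[OF FB.M.a_closed[OF coord_closed[OF x] coord_closed[OF y]]]
      module_hom_add[OF ph coord_closed[OF x] coord_closed[OF y]] proj_coord[OF x] proj_coord[OF y]
    by metis
qed

lemma basis_elem_kQ: "p \<in> paths \<Longrightarrow> d p \<in> carrier kQ"
  using F.basis_elem_carrier by simp

sublocale based_algebra K A B cls coord
proof (intro based_algebra.intro based_algebra_axioms.intro A_algebra B_finite coord_hom)
  note ph = proj_free_hom[OF B_paths]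
  show c: "cls b \<in> carrier A" if "b \<in> B" for b using that B_paths cls_closed by blast
  show "coord (cls b) = d b" if "b \<in> B" for b
    using that coord_proj[OF F.basis_elem_carrier] by (simp add: cls_eq)
  fix x assume x: "x \<in> carrier A"
  have "free_ext K A cls (coord x) = V.proj (coord x)"
    by (rule F.free_hom_eqI[OF A_vectorspace F.free_ext_hom[OF A_vectorspace c] ph])
      (use coord_closed[OF x] c in \<open>auto simp: F.free_ext_basis_elem[OF A_vectorspace] cls_eq\<close>)
  then show "free_ext K A cls (coord x) = x" by (simp only: proj_coord[OF x])
qed

text \<open>
  Two representatives of \<open>x\<close> differ by an element of \<open>I\<close>, and those vanish on short paths.
\<close>

lemma coord_short:
  assumes f: "f \<in> carrier kQ" and p: "p \<in> short"
  shows "coord (V.proj f) p = f p"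
proof -
  have x: "V.proj f \<in> carrier A" by (rule module_hom_mem[OF proj_hom f])
  define g where "g = coord (V.proj f)"
  have g: "g \<in> carrier kQ" unfolding g_def by (rule coord_kQ[OF x])
  have "V.proj f = V.proj g" unfolding g_def by (rule proj_coord[OF x, symmetric])
  then have fg: "f \<in> V.proj g" using V.proj_self[OF f] by simp
  then have "f \<ominus>\<^bsub>kQ\<^esub> g \<in> I" using V.proj_mem[OF g] by simp
  then have 0: "(f \<ominus>\<^bsub>kQ\<^esub> g) p = \<zero>\<^bsub>K\<^esub>" by (rule I_short_zero[OF _ p])
  have "f = (f \<ominus>\<^bsub>kQ\<^esub> g) \<oplus>\<^bsub>kQ\<^esub> g"
    using f g by (simp only: a_minus_def I.a_assoc I.a_inv_closed I.l_neg I.r_zero)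
  then have "f p = (f \<ominus>\<^bsub>kQ\<^esub> g) p \<oplus>\<^bsub>K\<^esub> g p" by (metis path_algebra_simps(3))
  then show ?thesis using 0 F.free_carrier_app[of g paths p] g by (simp add: g_def)
qed

lemma vertex_mult:
  assumes f: "f \<in> carrier kQ"
  shows "(d (s, []) \<otimes>\<^bsub>kQ\<^esub> f) (u, es) = (if u = s then f (u, es) else \<zero>\<^bsub>K\<^esub>)"
    and "(f \<otimes>\<^bsub>kQ\<^esub> d (s, [])) (u, es) = (if Qv.awlast u es = s then f (u, es) else \<zero>\<^bsub>K\<^esub>)"
proof -
  have fc: "f p \<in> carrier K" for p using f by simp
  have "(d (s, []) \<otimes>\<^bsub>kQ\<^esub> f) (u, es) =
      (\<Oplus>\<^bsub>K\<^esub> i \<in> {..length es}. if 0 = i then (if u = s then f (u, es) else \<zero>\<^bsub>K\<^esub>) else \<zero>\<^bsub>K\<^esub>)"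
    unfolding path_mult_apply by (rule F.finsum_cong') (use fc in \<open>auto simp: basis_elem_def\<close>)
  also have "\<dots> = (if u = s then f (u, es) else \<zero>\<^bsub>K\<^esub>)"
    by (rule F.finsum_singleton) (use fc in auto)
  finally show "(d (s, []) \<otimes>\<^bsub>kQ\<^esub> f) (u, es) = (if u = s then f (u, es) else \<zero>\<^bsub>K\<^esub>)" .
  have "(f \<otimes>\<^bsub>kQ\<^esub> d (s, [])) (u, es) =
      (\<Oplus>\<^bsub>K\<^esub> i \<in> {..length es}. if length es = i then (if Qv.awlast u es = s then f (u, es) else \<zero>\<^bsub>K\<^esub>) else \<zero>\<^bsub>K\<^esub>)"
    unfolding path_mult_apply by (rule F.finsum_cong') (use fc in \<open>auto simp: basis_elem_def\<close>)
  also have "\<dots> = (if Qv.awlast u es = s then f (u, es) else \<zero>\<^bsub>K\<^esub>)"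
    by (rule F.finsum_singleton) (use fc in auto)
  finally show "(f \<otimes>\<^bsub>kQ\<^esub> d (s, [])) (u, es) = (if Qv.awlast u es = s then f (u, es) else \<zero>\<^bsub>K\<^esub>)" .
qed

lemma free_restrict:
  assumes "f \<in> carrier (F.free B)" "\<And>p. g p = (if P p then f p else \<zero>\<^bsub>K\<^esub>)"
  shows "g \<in> carrier (F.free B)"
  by (rule F.free_carrierI[of _ _ B])
    (use assms F.free_outside[OF assms(1)] B_finite F.free_carrier_app[OF assms(1)] in \<open>auto split: if_splits\<close>)

text \<open>
  Multiplication by a trivial path only deletes paths from a combination of \<open>B\<close>, so the product is again a
  combination of \<open>B\<close> and no reduction modulo \<open>I\<close> takes place.
\<close>

lemma coord_vertex_mult:
  assumes s: "s \<in> verts Q" and x: "x \<in> carrier A"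
  shows "coord (cls (s, []) \<otimes>\<^bsub>A\<^esub> x) b = (if fst b = s then coord x b else \<zero>\<^bsub>K\<^esub>)"
    and "coord (x \<otimes>\<^bsub>A\<^esub> cls (s, [])) b = (if Qv.awlast (fst b) (snd b) = s then coord x b else \<zero>\<^bsub>K\<^esub>)"
proof -
  let ?f = "coord x" and ?e = "d (s, [])"
  have e: "?e \<in> carrier kQ" using s short_paths by (intro basis_elem_kQ) (auto simp: short_def)
  note f = coord_kQ[OF x]
  have "?e \<otimes>\<^bsub>kQ\<^esub> ?f \<in> carrier (F.free B)"
    by (rule free_restrict[OF coord_closed[OF x], of _ "\<lambda>p. fst p = s"]) (auto simp: vertex_mult[OF f])
  moreover have "cls (s, []) \<otimes>\<^bsub>A\<^esub> x = V.proj (?e \<otimes>\<^bsub>kQ\<^esub> ?f)"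
    using proj_mult[OF e f] proj_coord[OF x] by (simp only: cls_eq)
  ultimately show "coord (cls (s, []) \<otimes>\<^bsub>A\<^esub> x) b = (if fst b = s then ?f b else \<zero>\<^bsub>K\<^esub>)"
    using vertex_mult(1)[OF f, of s "fst b" "snd b"] by (simp only: coord_proj prod.collapse)
  have "?f \<otimes>\<^bsub>kQ\<^esub> ?e \<in> carrier (F.free B)"
    by (rule free_restrict[OF coord_closed[OF x], of _ "\<lambda>p. Qv.awlast (fst p) (snd p) = s"])
      (auto simp: vertex_mult[OF f])
  moreover have "x \<otimes>\<^bsub>A\<^esub> cls (s, []) = V.proj (?f \<otimes>\<^bsub>kQ\<^esub> ?e)"
    using proj_mult[OF f e] proj_coord[OF x] by (simp only: cls_eq)
  ultimately show "coord (x \<otimes>\<^bsub>A\<^esub> cls (s, [])) b =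
      (if Qv.awlast (fst b) (snd b) = s then ?f b else \<zero>\<^bsub>K\<^esub>)"
    using vertex_mult(2)[OF f, of s "fst b" "snd b"] by (simp only: coord_proj prod.collapse)
qed

text \<open>
  In contrast to trivial paths, multiplication by an arrow leads out of the combinations of \<open>B\<close>.  The
  coefficients at short paths are unaffected by the reduction modulo \<open>I\<close>.
\<close>

lemma coord_arrow_mult:
  assumes e: "e \<in> arcs Q" and x: "x \<in> carrier A"
  defines "\<alpha> \<equiv> (tail Q e, [e])"
  shows "v \<in> verts Q \<Longrightarrow> coord (cls \<alpha> \<otimes>\<^bsub>A\<^esub> x) (v, []) = \<zero>\<^bsub>K\<^esub>"
    and "v \<in> verts Q \<Longrightarrow> coord (x \<otimes>\<^bsub>A\<^esub> cls \<alpha>) (v, []) = \<zero>\<^bsub>K\<^esub>"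
    and "coord (cls \<alpha> \<otimes>\<^bsub>A\<^esub> x) \<alpha> = coord x (head Q e, [])"
    and "coord (x \<otimes>\<^bsub>A\<^esub> cls \<alpha>) \<alpha> = coord x (tail Q e, [])"
proof -
  let ?f = "coord x"
  have short: "\<alpha> \<in> short" using e by (auto simp: short_def \<alpha>_def)
  have a: "d \<alpha> \<in> carrier kQ" using short short_paths by (intro basis_elem_kQ) auto
  note f = coord_kQ[OF x]
  have fc: "?f p \<in> carrier K" for p using f by simp
  have l: "cls \<alpha> \<otimes>\<^bsub>A\<^esub> x = V.proj (d \<alpha> \<otimes>\<^bsub>kQ\<^esub> ?f)"
    using proj_mult[OF a f] proj_coord[OF x] by (simp only: cls_eq)
  have r: "x \<otimes>\<^bsub>A\<^esub> cls \<alpha> = V.proj (?f \<otimes>\<^bsub>kQ\<^esub> d \<alpha>)"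
    using proj_mult[OF f a] proj_coord[OF x] by (simp only: cls_eq)
  note cs = coord_short[OF I.m_closed[OF a f]] coord_short[OF I.m_closed[OF f a]]
  have v: "(v, []) \<in> short" if "v \<in> verts Q" using that by (auto simp: short_def)
  show "v \<in> verts Q \<Longrightarrow> coord (cls \<alpha> \<otimes>\<^bsub>A\<^esub> x) (v, []) = \<zero>\<^bsub>K\<^esub>"
    unfolding l cs(1)[OF v] path_mult_trivial[OF a f] using fc by (simp add: basis_elem_def \<alpha>_def)
  show "v \<in> verts Q \<Longrightarrow> coord (x \<otimes>\<^bsub>A\<^esub> cls \<alpha>) (v, []) = \<zero>\<^bsub>K\<^esub>"
    unfolding r cs(2)[OF v] path_mult_trivial[OF f a] using fc by (simp add: basis_elem_def \<alpha>_def)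
  show "coord (cls \<alpha> \<otimes>\<^bsub>A\<^esub> x) \<alpha> = ?f (head Q e, [])"
    unfolding l cs(1)[OF short] using fc
    by (subst \<alpha>_def(1)) (simp add: path_mult_arrow[OF a f], simp add: basis_elem_def \<alpha>_def)
  show "coord (x \<otimes>\<^bsub>A\<^esub> cls \<alpha>) \<alpha> = ?f (tail Q e, [])"
    unfolding r cs(2)[OF short] using fc
    by (subst \<alpha>_def(1)) (simp add: path_mult_arrow[OF f a], simp add: basis_elem_def \<alpha>_def)
qed

end


section \<open>The conditions imposed by vertices and arrows\<close>

context based_quiver_algebra
begin

abbreviation "ends p \<equiv> Qv.awlast (fst p) (snd p)"

text \<open>
  The pairs \<open>b \<otimes> c\<close> at which a central tensor can have a nonzero coefficient because of the trivial paths;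
  those among them whose coefficient vanishes because of an arrow; those whose coefficient equals the one
  at \<open>(\<alpha>, e\<^sub>i)\<close> for an arrow \<open>\<alpha>\<close> with tail \<open>i\<close>; and the remaining ones, which determine the tensor.
\<close>

definition "composable = {(b, c) \<in> B \<times> B. fst b = ends c}"
definition "vertex_pairs = (\<lambda>v. ((v, []), (v, []))) ` verts Q"
definition "arrow_pairs = (\<lambda>e. ((head Q e, []), (tail Q e, [e]))) ` arcs Q"
definition "free_pairs = composable - vertex_pairs - arrow_pairs"

lemma vertex_in_B: "v \<in> verts Q \<Longrightarrow> (v, []) \<in> B"
  and arrow_in_B: "e \<in> arcs Q \<Longrightarrow> (tail Q e, [e]) \<in> B"
  using B_short by (auto simp: short_def)

text \<open>
  Compare the coefficients of \<open>e t\<close> and \<open>t e\<close> at \<open>b \<otimes> c\<close>, where \<open>e\<close> is the trivial path at the start of \<open>b\<close>: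
  multiplication by \<open>e\<close> from the left keeps \<open>b\<close>, from the right it deletes \<open>c\<close>.
\<close>

lemma central_coord_noncomposable:
  assumes t: "t \<in> carrier AA.T" and central: "\<And>a. a \<in> carrier A \<Longrightarrow> act a t \<one>\<^bsub>A\<^esub> = act \<one>\<^bsub>A\<^esub> t a"
    and b: "b \<in> B" and ne: "fst b \<noteq> ends c"
  shows "tensor_coord t (b, c) = \<zero>\<^bsub>K\<^esub>"
proof -
  have s: "fst b \<in> verts Q"
    using b B_paths by (auto simp: quiver_paths_def Qv.awalk_def)
  let ?e = "cls (fst b, [])"
  have e: "?e \<in> carrier A" by (rule cl_closed[OF vertex_in_B[OF s]])
  have "tensor_coord t (b, c) = tensor_coord (act ?e t \<one>\<^bsub>A\<^esub>) (b, c)"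
    by (rule tensor_coord_act_eq[symmetric, OF e one_closed t]) (simp add: coord_vertex_mult(1)[OF s])
  also have "\<dots> = tensor_coord (act \<one>\<^bsub>A\<^esub> t ?e) (b, c)" by (simp only: central[OF e])
  also have "\<dots> = \<zero>\<^bsub>K\<^esub>"
    by (rule tensor_coord_act_zero[OF one_closed e t]) (use ne in \<open>simp add: coord_vertex_mult(2)[OF s]\<close>)
  finally show ?thesis .
qed

text \<open>
  Compare the coefficients of \<open>\<alpha> t\<close> and \<open>t \<alpha>\<close> at \<open>i \<otimes> \<alpha>\<close>, \<open>\<alpha> \<otimes> j\<close> and \<open>\<alpha> \<otimes> \<alpha>\<close>.  A product with \<open>\<alpha>\<close> has no trivial
  path in it, and \<open>\<alpha>\<close> occurs in it only through the trivial path at the appropriate end of \<open>\<alpha>\<close>.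
\<close>

lemma central_coord_arrow:
  assumes t: "t \<in> carrier AA.T" and central: "\<And>a. a \<in> carrier A \<Longrightarrow> act a t \<one>\<^bsub>A\<^esub> = act \<one>\<^bsub>A\<^esub> t a"
    and e: "e \<in> arcs Q"
  defines "\<alpha> \<equiv> (tail Q e, [e])" and "i \<equiv> (tail Q e, [])" and "j \<equiv> (head Q e, [])"
  shows "tensor_coord t (i, i) = \<zero>\<^bsub>K\<^esub>" "tensor_coord t (j, j) = \<zero>\<^bsub>K\<^esub>"
    "tensor_coord t (j, \<alpha>) = tensor_coord t (\<alpha>, i)"
proof -
  have a: "cls \<alpha> \<in> carrier A" unfolding \<alpha>_def by (rule cl_closed[OF arrow_in_B[OF e]])
  have v: "tail Q e \<in> verts Q" "head Q e \<in> verts Q" using e by auto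
  note c = central[OF a]
  note am = coord_arrow_mult[OF e, folded \<alpha>_def]
  have "tensor_coord t (i, i) = tensor_coord (act \<one>\<^bsub>A\<^esub> t (cls \<alpha>)) (i, \<alpha>)"
    by (rule tensor_coord_act_eq[symmetric, OF one_closed a t]) (simp add: am(4) i_def)
  also have "\<dots> = tensor_coord (act (cls \<alpha>) t \<one>\<^bsub>A\<^esub>) (i, \<alpha>)" by (simp only: c)
  also have "\<dots> = \<zero>\<^bsub>K\<^esub>"
    by (rule tensor_coord_act_zero[OF a one_closed t]) (simp add: am(1) v i_def)
  finally show "tensor_coord t (i, i) = \<zero>\<^bsub>K\<^esub>" .
  have "tensor_coord t (j, j) = tensor_coord (act (cls \<alpha>) t \<one>\<^bsub>A\<^esub>) (\<alpha>, j)"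
    by (rule tensor_coord_act_eq[symmetric, OF a one_closed t]) (simp add: am(3) j_def)
  also have "\<dots> = tensor_coord (act \<one>\<^bsub>A\<^esub> t (cls \<alpha>)) (\<alpha>, j)" by (simp only: c)
  also have "\<dots> = \<zero>\<^bsub>K\<^esub>"
    by (rule tensor_coord_act_zero[OF one_closed a t]) (simp add: am(2) v j_def)
  finally show "tensor_coord t (j, j) = \<zero>\<^bsub>K\<^esub>" .
  have "tensor_coord t (j, \<alpha>) = tensor_coord (act (cls \<alpha>) t \<one>\<^bsub>A\<^esub>) (\<alpha>, \<alpha>)"
    by (rule tensor_coord_act_eq[symmetric, OF a one_closed t]) (simp add: am(3) j_def)
  also have "\<dots> = tensor_coord (act \<one>\<^bsub>A\<^esub> t (cls \<alpha>)) (\<alpha>, \<alpha>)" by (simp only: c)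
  also have "\<dots> = tensor_coord t (\<alpha>, i)"
    by (rule tensor_coord_act_eq[OF one_closed a t]) (simp add: am(4) i_def)
  finally show "tensor_coord t (j, \<alpha>) = tensor_coord t (\<alpha>, i)" .
qed

text \<open>
  By the two previous lemmas a central tensor whose coefficients vanish on \<open>free_pairs\<close> is zero.  The
  assumption is what connectedness of the quiver is used for: if \<open>v\<close> is an isolated vertex, then
  \<open>e\<^sub>v \<otimes> e\<^sub>v\<close> is central.
\<close>

lemma Frobdim_le_free_pairs:
  assumes inc: "\<And>v. v \<in> verts Q \<Longrightarrow> \<exists>e\<in>arcs Q. tail Q e = v \<or> head Q e = v"
  shows "Frobdim K A \<le> card free_pairs"
proof -
  let ?W = "F.free free_pairs"
  let ?f = "\<lambda>t q. if q \<in> free_pairs then tensor_coord t q else \<zero>\<^bsub>K\<^esub>"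
  have sub: "free_pairs \<subseteq> B \<times> B" by (auto simp: free_pairs_def composable_def)
  then have fin: "finite free_pairs" using B_finite finite_subset by blast
  have tc: "tensor_coord t \<in> carrier FBB" "tensor_coord t q \<in> carrier K" if "t \<in> carrier AA.T" for t q
    using module_hom_mem[OF tensor_coord_hom that] by auto
  have f: "?f \<in> module_hom K AA.T ?W"
    by (rule module_homI)
      (use fin tc in \<open>auto intro!: F.free_carrierI[of _ _ free_pairs] split: if_splits
        simp: fun_eq_iff module_hom_add[OF tensor_coord_hom] module_hom_smult[OF tensor_coord_hom]\<close>)
  have "Frobdim K A \<le> vectorspace.dim K ?W"
  proof (rule Frobdim_le[OF F.free_vectorspace F.free_dim(1)[OF fin] f])
    fix t assume t: "t \<in> carrier AA.T"
      and central: "\<And>a. a \<in> carrier A \<Longrightarrow> act a t \<one>\<^bsub>A\<^esub> = act \<one>\<^bsub>A\<^esub> t a" and z: "?f t = \<zero>\<^bsub>?W\<^esub>"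
    have free: "tensor_coord t q = \<zero>\<^bsub>K\<^esub>" if "q \<in> free_pairs" for q
      using fun_cong[OF z, of q] that by simp
    note arrow = central_coord_arrow[OF t central]
    have "tensor_coord t q = \<zero>\<^bsub>K\<^esub>" for q
    proof -
      consider "q \<notin> B \<times> B" | "q \<in> B \<times> B" "q \<notin> composable" | "q \<in> vertex_pairs" | "q \<in> arrow_pairs"
        | "q \<in> free_pairs"
        unfolding free_pairs_def by blast
      then show ?thesis
      proof cases
        case 1 then show ?thesis using F.free_outside[OF tc(1)[OF t]] by blast
      next
        case 2 then show ?thesis
          using central_coord_noncomposable[OF t central, of "fst q" "snd q"]
          by (cases q) (auto simp: composable_def)
      next
        case 3
        then obtain v where v: "v \<in> verts Q" "q = ((v, []), (v, []))" by (auto simp: vertex_pairs_def)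
        then show ?thesis using inc[OF v(1)] arrow(1,2) by auto
      next
        case 4
        then obtain e where e: "e \<in> arcs Q" "q = ((head Q e, []), (tail Q e, [e]))"
          by (auto simp: arrow_pairs_def)
        have "((tail Q e, [e]), (tail Q e, [])) \<in> free_pairs"
          using e arrow_in_B vertex_in_B by (auto simp: free_pairs_def composable_def vertex_pairs_def arrow_pairs_def)
        then show ?thesis using arrow(3)[OF _ e(1)] free e by simp
      next
        case 5 then show ?thesis by (rule free)
      qed
    qed
    then show "t = \<zero>\<^bsub>AA.T\<^esub>" by (intro tensor_coord_inj[OF t]) (auto simp: fun_eq_iff)
  qed
  then show ?thesis using F.free_dim(2)[OF fin] by simp
qed

section \<open>Counting the remaining coordinates\<close>

lemma card_basis_le: "vectorspace.fin_dim K A \<Longrightarrow> card B \<le> vectorspace.dim K A"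
  using linear_inj_dim_le(2)[OF F.free_vectorspace A_vectorspace proj_free_hom[OF B_paths] B_inj]
    F.free_dim(2)[OF B_finite] by simp

lemma card_basis_part_le:
  assumes "vectorspace.fin_dim K A" "S \<subseteq> paths"
  shows "card (B \<inter> S) \<le> span_dim K A (cls ` S)"
  by (rule independent_card_le)
    (use assms path_basis B_paths B_finite F.free_mono[of "B \<inter> S" B] in \<open>auto simp: path_basis_def\<close>)

lemma path_ends:
  assumes "(u, es) \<in> paths"
  shows "u \<in> verts Q" "Qv.awalk u es (Qv.awlast u es)" "Qv.awlast u es \<in> verts Q"
proof -
  obtain v where v: "Qv.awalk u es v" using assms by (auto simp: quiver_paths_def)
  then have "Qv.awlast u es = v" by (auto simp: Qv.awalk_def Qv.awlast_if_cas)
  then show "u \<in> verts Q" "Qv.awalk u es (Qv.awlast u es)" "Qv.awlast u es \<in> verts Q"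
    using v Qv.awalk_last_in_verts by (auto simp: Qv.awalk_def)
qed

lemma basis_ends:
  assumes "b \<in> B"
  shows "fst b \<in> verts Q" "Qv.awalk (fst b) (snd b) (ends b)" "ends b \<in> verts Q"
  using assms B_paths path_ends[of "fst b" "snd b"] by auto

lemma card_starting:
  assumes "v \<in> verts Q"
  shows "card {b \<in> B. fst b = v} = Suc (card (B \<inter> paths_from Q v))"
proof -
  have "b \<in> insert (v, []) (B \<inter> paths_from Q v)" if "b \<in> B" "fst b = v" for b
    using basis_ends(2)[OF that(1)] that by (cases b) (auto simp: paths_from_def)
  then have "{b \<in> B. fst b = v} = insert (v, []) (B \<inter> paths_from Q v)"
    using vertex_in_B[OF assms] by (auto simp: paths_from_def)
  then show ?thesis using B_finite by (simp add: paths_from_def)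
qed

lemma card_ending:
  assumes "v \<in> verts Q"
  shows "card {c \<in> B. ends c = v} = Suc (card (B \<inter> paths_to Q v))"
proof -
  have "c \<in> insert (v, []) (B \<inter> paths_to Q v)" if "c \<in> B" "ends c = v" for c
    using basis_ends(2)[OF that(1)] that by (cases c) (auto simp: paths_to_def)
  then have "{c \<in> B. ends c = v} = insert (v, []) (B \<inter> paths_to Q v)"
    using vertex_in_B[OF assms] by (auto simp: paths_to_def Qv.awalk_def Qv.awlast_if_cas)
  then show ?thesis using B_finite by (simp add: paths_to_def)
qed

lemma card_by_vertex:
  assumes "\<And>b. b \<in> B \<Longrightarrow> h b \<in> verts Q"
  shows "(\<Sum>v\<in>verts Q. card {b \<in> B. h b = v}) = card B"
proof -
  have "B = (\<Union>v\<in>verts Q. {b \<in> B. h b = v})" using assms by auto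
  then have "card B = card (\<Union>v\<in>verts Q. {b \<in> B. h b = v})" by simp
  also have "\<dots> = (\<Sum>v\<in>verts Q. card {b \<in> B. h b = v})"
    by (rule card_UN_disjoint) (use B_finite in auto)
  finally show ?thesis by simp
qed

lemma card_composable:
  "card composable = (\<Sum>v\<in>verts Q. card {b \<in> B. fst b = v} * card {c \<in> B. ends c = v})"
proof -
  have "composable = (\<Union>v\<in>verts Q. {b \<in> B. fst b = v} \<times> {c \<in> B. ends c = v})"
    using basis_ends(1) by (auto simp: composable_def)
  also have "card \<dots> = (\<Sum>v\<in>verts Q. card ({b \<in> B. fst b = v} \<times> {c \<in> B. ends c = v}))"
    by (rule card_UN_disjoint) (use B_finite in auto)
  finally show ?thesis by (simp add: card_cartesian_product)
qed

lemma card_free_pairs: "card free_pairs + card (verts Q) + card (arcs Q) = card composable"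
proof -
  have inj: "inj_on (\<lambda>v. ((v, []), (v, []))) (verts Q)"
    "inj_on (\<lambda>e. ((head Q e, []), (tail Q e, [e]))) (arcs Q)"
    by (auto simp: inj_on_def)
  have fin: "finite composable" using B_finite by (auto simp: composable_def intro: finite_subset[of _ "B \<times> B"])
  have "vertex_pairs \<subseteq> composable" "arrow_pairs \<subseteq> composable"
    using vertex_in_B arrow_in_B by (auto simp: composable_def vertex_pairs_def arrow_pairs_def)
  moreover have "vertex_pairs \<inter> arrow_pairs = {}" by (auto simp: vertex_pairs_def arrow_pairs_def)
  moreover have "free_pairs = composable - (vertex_pairs \<union> arrow_pairs)" by (auto simp: free_pairs_def)
  moreover have "card vertex_pairs = card (verts Q)" "card arrow_pairs = card (arcs Q)"
    unfolding vertex_pairs_def arrow_pairs_def by (auto simp: card_image inj)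
  ultimately show ?thesis
    using fin card_Diff_subset[of "vertex_pairs \<union> arrow_pairs" composable]
      card_Un_disjoint[of vertex_pairs arrow_pairs] card_mono[OF fin, of "vertex_pairs \<union> arrow_pairs"]
    by (metis (no_types, lifting) finite_subset le_add_diff_inverse2 Un_least add.assoc)
qed

text \<open>
  With \<open>p\<close> and \<open>m\<close> counting the basis paths of positive length that start and end at a vertex, expand
  \<open>(1 + p) (1 + m) = p m + (1 + p) + (1 + m) - 1\<close>; each basis path has one start and one end, so the two middle
  terms sum up to \<open>|B|\<close> each.
\<close>

lemma card_free_pairs_le:
  assumes fd: "vectorspace.fin_dim K A"
  shows "int (card free_pairs) \<le> (\<Sum>v\<in>verts Q. int (gP_plus K Q I v) * int (gP_minus K Q I v))
    + 2 * (int (vectorspace.dim K A) - int (card (verts Q))) - int (card (arcs Q))"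
proof -
  let ?p = "\<lambda>v. card (B \<inter> paths_from Q v)" and ?m = "\<lambda>v. card (B \<inter> paths_to Q v)"
  have starts: "(\<Sum>v\<in>verts Q. Suc (?p v)) = card B"
    using card_by_vertex[of fst] basis_ends(1) by (simp add: card_starting cong: sum.cong)
  have ending: "(\<Sum>v\<in>verts Q. Suc (?m v)) = card B"
    using card_by_vertex[of ends] basis_ends(3) by (simp add: card_ending cong: sum.cong)
  have "card composable = (\<Sum>v\<in>verts Q. Suc (?p v) * Suc (?m v))"
    by (simp only: card_composable card_starting card_ending cong: sum.cong)
  also have "int \<dots> = (\<Sum>v\<in>verts Q. int (?p v) * int (?m v) + int (Suc (?p v)) + int (Suc (?m v)) - 1)"
    by (simp add: algebra_simps)
  also have "\<dots> = (\<Sum>v\<in>verts Q. int (?p v) * int (?m v)) + int (\<Sum>v\<in>verts Q. Suc (?p v))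
      + int (\<Sum>v\<in>verts Q. Suc (?m v)) - int (card (verts Q))"
    by (simp add: sum.distrib sum_subtractf)
  finally have c: "int (card composable)
      = (\<Sum>v\<in>verts Q. int (?p v) * int (?m v)) + 2 * int (card B) - int (card (verts Q))"
    unfolding starts ending by simp
  have "?p v \<le> gP_plus K Q I v" "?m v \<le> gP_minus K Q I v" for v
    unfolding gP_plus_def gP_minus_def
    by (rule card_basis_part_le[OF fd]; force simp: quiver_paths_def paths_from_def paths_to_def)+
  then have le: "(\<Sum>v\<in>verts Q. int (?p v) * int (?m v))
      \<le> (\<Sum>v\<in>verts Q. int (gP_plus K Q I v) * int (gP_minus K Q I v))"
    by (intro sum_mono mult_mono) auto
  have free: "int (card free_pairs) = int (card composable) - int (card (verts Q)) - int (card (arcs Q))"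
    using card_free_pairs by linarith
  have "int (card B) \<le> int (vectorspace.dim K A)" using card_basis_le[OF fd] by simp
  with le show ?thesis unfolding free c by (simp add: algebra_simps)
qed

end

lemma (in fin_digraph) connected_incident_arc:
  assumes conn: "connected G" and card: "card (verts G) \<ge> 2" and v: "v \<in> verts G"
  shows "\<exists>e\<in>arcs G. tail G e = v \<or> head G e = v"
proof -
  have "verts G \<noteq> {v}" using card by auto
  then obtain w where w: "w \<in> verts G" "w \<noteq> v" using v by blast
  have "v \<rightarrow>\<^sup>*\<^bsub>mk_symmetric G\<^esub> w"
    using conn v w by (auto simp: connected_def strongly_connected_def)
  then obtain u where "v \<rightarrow>\<^bsub>mk_symmetric G\<^esub> u"
    using w by (auto elim: converse_rtrancl_on_cases simp: reachable_def)
  then show ?thesis by (auto simp: parcs_mk_symmetric arcs_ends_def arc_to_ends_def)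
qed

theorem theorem25:
  fixes K :: "('k, 'r) ring_scheme"
    and Q :: "('v, 'e) pre_digraph"
    and I :: "('v \<times> 'e awalk \<Rightarrow> 'k) set"
    and A :: "('k, ('v \<times> 'e awalk \<Rightarrow> 'k) set) module"
    and k n :: nat
  assumes "field K"
    and "fin_digraph Q" and "Digraph_Component.connected Q"
    and "card (verts Q) = k" and "k \<ge> 2"
    and "admissible_ideal K Q I"
    and "A = bound_quiver_algebra K Q I"
    and "vectorspace.fin_dim K A" and "vectorspace.dim K A = n"
  shows "int (Frobdim K A)
    \<le> (\<Sum>i\<in>verts Q. int (gP_plus K Q I i) * int (gP_minus K Q I i))
        + 2 * (int n - int k) - int (card (arcs Q))"
proof -
  interpret admissible_quotient K Q I
    using assms by (auto simp: admissible_quotient_def admissible_quotient_axioms_def)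
  have fd: "vectorspace.fin_dim K (bound_quiver_algebra K Q I)" using assms by simp
  obtain B where "path_basis B" using path_basis_exists[OF fd] by blast
  then interpret based_quiver_algebra K Q I B by unfold_locales
  have "Frobdim K A \<le> card free_pairs"
    unfolding assms(7)
    by (rule Frobdim_le_free_pairs) (use Qv.connected_incident_arc assms in blast)
  then show ?thesis using card_free_pairs_le[OF fd] assms by simp
qed


end
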